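(* Let $U=I\times J\times Y\subset\mathbb{R}^4$, where $I,J\subset\mathbb{R}$ are open intervals containing $0$ and $Y\subset\mathbb{R}^2$ is a neighborhood of $0$. Let $\Phi=\Phi(x,y):U\to\mathbb{R}$ (with $x=(x_1,x_2)\in I\times J$, $y\in Y$) have finite $C^3(U)$ norm. Suppose that $$\Phi(x,0)=x_2+O(|x|^3)\quad\text{as }x\to0,$$ and that the $2\times2$ matrix $$d_y\begin{pmatrix}\partial_{x_1}\Phi(x,y)\\ \partial_{x_1}^2\Phi(x,y)/|\nabla_x\Phi(x,y)|\end{pmatrix}\Big|_{(x,y)=(0,0)}$$ is invertible. Then, after possibly replacing $I$, $J$ and $Y$ by smaller intervals/neighborhoods containing $0$ (with $I$ now taken to be compact with $0$ in its interior), there is an interval $R$ containing $0$ in its interior such that for each $(y,r)\in Y\times R$ the curve $\{x\in I\times J:\Phi(x,y)=r\}$ is the graph $x_2=f_{y,r}(x_1)$ of a function $f_{y,r}\in C^2(I)$, and $\{f_{y,r}:(y,r)\in Y\times R\}\subset C^2(I)$ is a family of cinematic functions (for some finite cinematic constant and doubling constant). Specifically, there exists $\varepsilon>0$ so that for all $(y,r),(y',r')\in Y\times R$ and all $x_1\in I$, $$|f_{y,r}(x_1)-f_{y',r'}(x_1)|+|\dot f_{y,r}(x_1)-\dot f_{y',r'}(x_1)|+|\ddot f_{y,r}(x_1)-\ddot f_{y',r'}(x_1)|\ge\varepsilon\,|(y,r)-(y',r')|.$$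
   Context: $\|f\|_{C^2(I)}=\sup_I|f|+\sup_I|f'|+\sup_I|f''|$. For a compact interval $I$, a set $\mathcal{F}\subset C^2(I)$ is a family of cinematic functions with cinematic constant $K$ and doubling constant $D$ if (1) $\mathcal{F}$ has diameter at most $K$ in $C^2(I)$; (2) $\mathcal{F}$ is a doubling metric space with doubling constant at most $D$ (every ball of radius $r$ in $\mathcal F$ can be covered by at most $D$ balls of radius $r/2$); (3) for all $f,g\in\mathcal{F}$, $\inf_{t\in I}\big(|f(t)-g(t)|+|f'(t)-g'(t)|+|f''(t)-g''(t)|\big)\ge K^{-1}\|f-g\|_{C^2(I)}$. Here $d_y$ denotes the differential in the $y\in\mathbb{R}^2$ variable and $\nabla_x$ the gradient in $x$. *)

theory Defs
  imports "HOL-Analysis.Analysis" "HOL-Library.Landau_Symbols"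
begin

section \<open>Functions with finite \<open>C\<^sup>k\<close> norm\<close>

text \<open>
  For an open set \<open>U\<close>: \<open>f\<close> is of class \<open>C\<^sup>k\<close> on \<open>U\<close> and all its partial
  derivatives of order at most \<open>k\<close> are bounded on \<open>U\<close>. The functions
  \<open>\<lambda>z. frechet_derivative f (at z) b\<close> with \<open>b \<in> Basis\<close> are the first-order partial
  derivatives of \<open>f\<close>.
\<close>

primrec finite_Ck_norm ::
  "nat \<Rightarrow> ('a::euclidean_space \<Rightarrow> real) \<Rightarrow> 'a set \<Rightarrow> bool" where
  "finite_Ck_norm 0 f U \<longleftrightarrow> continuous_on U f \<and> bounded (f ` U)"
| "finite_Ck_norm (Suc k) f U \<longleftrightarrow>
     bounded (f ` U) \<and> (\<forall>z\<in>U. f differentiable (at z)) \<and>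
     (\<forall>b\<in>Basis. finite_Ck_norm k (\<lambda>z. frechet_derivative f (at z) b) U)"

section \<open>The space \<open>C\<^sup>2(I)\<close> of a compact interval\<close>

text \<open>Derivatives are taken within \<open>I\<close>, hence one-sided at the end points.\<close>

definition D1 :: "real set \<Rightarrow> (real \<Rightarrow> real) \<Rightarrow> real \<Rightarrow> real" where
  "D1 I f t = vector_derivative f (at t within I)"

definition D2 :: "real set \<Rightarrow> (real \<Rightarrow> real) \<Rightarrow> real \<Rightarrow> real" where
  "D2 I f = D1 I (D1 I f)"

text \<open>
  Restricting to \<open>extensional I\<close> identifies functions that agree on \<open>I\<close>, so that
  \<open>C2_dist I\<close> below is a metric on \<open>C2_space I\<close>, not just a pseudometric.
\<close>

definition C2_space :: "real set \<Rightarrow> (real \<Rightarrow> real) set" where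
  "C2_space I = {f \<in> extensional I.
     f differentiable_on I \<and> D1 I f differentiable_on I \<and> continuous_on I (D2 I f)}"

definition C2_norm :: "real set \<Rightarrow> (real \<Rightarrow> real) \<Rightarrow> real" where
  "C2_norm I f = (SUP t\<in>I. \<bar>f t\<bar>) + (SUP t\<in>I. \<bar>D1 I f t\<bar>) + (SUP t\<in>I. \<bar>D2 I f t\<bar>)"

definition C2_dist :: "real set \<Rightarrow> (real \<Rightarrow> real) \<Rightarrow> (real \<Rightarrow> real) \<Rightarrow> real" where
  "C2_dist I f g = C2_norm I (\<lambda>t. f t - g t)"

definition pointwise_C2_diff ::
  "real set \<Rightarrow> (real \<Rightarrow> real) \<Rightarrow> (real \<Rightarrow> real) \<Rightarrow> real \<Rightarrow> real" where
  "pointwise_C2_diff I f g t =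
     \<bar>f t - g t\<bar> + \<bar>D1 I f t - D1 I g t\<bar> + \<bar>D2 I f t - D2 I g t\<bar>"

section \<open>Families of cinematic functions\<close>

definition doubling_constant_at_most ::
  "'a set \<Rightarrow> ('a \<Rightarrow> 'a \<Rightarrow> real) \<Rightarrow> nat \<Rightarrow> bool" where
  "doubling_constant_at_most M d D \<longleftrightarrow>
     (\<forall>x\<in>M. \<forall>r>0. \<exists>C\<subseteq>M. finite C \<and> card C \<le> D \<and>
        {z\<in>M. d x z < r} \<subseteq> (\<Union>c\<in>C. {z\<in>M. d c z < r / 2}))"

definition cinematic_family ::
  "real set \<Rightarrow> real \<Rightarrow> nat \<Rightarrow> (real \<Rightarrow> real) set \<Rightarrow> bool" where
  "cinematic_family I K D F \<longleftrightarrow>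
     0 < K \<and> F \<subseteq> C2_space I \<and>
     (\<forall>f\<in>F. \<forall>g\<in>F. C2_dist I f g \<le> K) \<and>
     doubling_constant_at_most F (C2_dist I) D \<and>
     (\<forall>f\<in>F. \<forall>g\<in>F. (INF t\<in>I. pointwise_C2_diff I f g t) \<ge> inverse K * C2_dist I f g)"

section \<open>Derivatives of the defining function\<close>

text \<open>
  A point of \<open>I \<times> J \<times> Y\<close> is written \<open>(x1, x2, y)\<close>. The product norm is
  Euclidean.
\<close>

definition dx1 :: "(real \<times> real \<times> (real^2) \<Rightarrow> real) \<Rightarrow> real \<times> real \<times> (real^2) \<Rightarrow> real" where
  "dx1 \<Phi> = (\<lambda>(x1, x2, y). deriv (\<lambda>s. \<Phi> (s, x2, y)) x1)"

definition dx2 :: "(real \<times> real \<times> (real^2) \<Rightarrow> real) \<Rightarrow> real \<times> real \<times> (real^2) \<Rightarrow> real" where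
  "dx2 \<Phi> = (\<lambda>(x1, x2, y). deriv (\<lambda>s. \<Phi> (x1, s, y)) x2)"

definition grad_x ::
  "(real \<times> real \<times> (real^2) \<Rightarrow> real) \<Rightarrow> real \<times> real \<times> (real^2) \<Rightarrow> real \<times> real" where
  "grad_x \<Phi> p = (dx1 \<Phi> p, dx2 \<Phi> p)"

definition cinematic_map ::
  "(real \<times> real \<times> (real^2) \<Rightarrow> real) \<Rightarrow> real \<times> real \<times> (real^2) \<Rightarrow> real^2" where
  "cinematic_map \<Phi> p = vector [dx1 \<Phi> p, dx1 (dx1 \<Phi>) p / norm (grad_x \<Phi> p)]"

end

(*
  With q = - Phi_1 / Phi_2 (subscripts are x-derivatives), the level curve x_2 = f(x_1) satisfies
  f' = q and f'' = w along the curve, where w = q_1 + q q_2 involves only second derivatives of Phi.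
  So the jet of f at a fixed abscissa is the value of (x_2, y) |-> (x_2, q, w). At the origin this
  map has a strict derivative, and it is injective: since Phi_1 and Phi_11 vanish at 0 while
  Phi_2 = 1, the y-derivative of (q, w) is, up to an invertible triangular factor, minus that of
  the map assumed nondegenerate. Near 0 it is therefore bilipschitz, and so is (x_2, y) |-> (Phi, y),
  which exchanges (x_2, y) for the parameters (r, y). Hence the C^2 jets are bilipschitz in (y, r)
  uniformly in x_1; no smooth dependence of f on the parameters is needed. A bilipschitz image of
  a bounded subset of R^3 is doubling.
*)
theory Submission
  imports Defs
begin

text \<open>Everything is assumed at the single point 0, while the conclusion compares arbitrary
  pairs of curves at every abscissa of an interval. Strict differentiability carries a condition at
  0 over to all pairs of points in a ball; it is available for \<Phi>, \<open>q\<close> and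
  \<open>w\<close> because \<Phi> is C^3, so that \<open>w\<close>, built from second derivatives,
  is still C^1. Curves are only compared at a common abscissa, so two points on them differ by a
  vector (0, h, k), with h the difference of the heights and k that of the parameters
  \<open>y\<close>. The number h is itself a jet coordinate. Hence the dependence of
  \<open>q\<close> and \<open>w\<close> on x_2, and the part of the linearisation errors
  proportional to h, are absorbed into a constant, and nondegeneracy is used in the k-direction
  alone. The level \<open>r\<close> is not an argument of the jet map. It is recovered last, as the
  value of \<Phi> at a point whose height and \<open>y\<close> are already controlled.\<close>

section \<open>Strict derivatives\<close>

text \<open>
  Both points vary: this one-point condition already controls difference quotients in a whole
  neighbourhood, so bilipschitz bounds near \<open>p\<close> can be read off \<open>f'\<close>.
\<close>

definition has_strict_derivative ::
  "('a::real_normed_vector \<Rightarrow> real) \<Rightarrow> ('a \<Rightarrow> real) \<Rightarrow> 'a \<Rightarrow> bool" where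
  "has_strict_derivative f f' p \<longleftrightarrow> bounded_linear f' \<and>
     (\<lambda>(u, v). f u - f v - f' (u - v)) \<in> o[nhds p \<times>\<^sub>F nhds p](\<lambda>(u, v). norm (u - v))"

lemma has_strict_derivativeD:
  assumes "has_strict_derivative f f' p" "e > 0"
  shows "\<forall>\<^sub>F (u, v) in nhds p \<times>\<^sub>F nhds p. \<bar>f u - f v - f' (u - v)\<bar> \<le> e * norm (u - v)"
  using landau_o.smallD[OF conjunct2[OF assms(1)[unfolded has_strict_derivative_def]] assms(2)]
  by (simp add: case_prod_unfold)

lemma bounded_linear_diff_bigo:
  fixes f' :: "'a::real_normed_vector \<Rightarrow> real"
  assumes "bounded_linear f'"
  shows "(\<lambda>(u, v). f' (u - v)) \<in> O[F](\<lambda>(u, v). norm (u - v))"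
proof -
  obtain K where "\<And>x. norm (f' x) \<le> norm x * K"
    using bounded_linear.bounded[OF assms] by blast
  then show ?thesis
    by (intro bigoI[where c = K]) (auto simp: case_prod_unfold mult.commute)
qed

lemma has_strict_derivative_diff_bigo:
  assumes "has_strict_derivative f f' p"
  shows "(\<lambda>(u, v). f u - f v) \<in> O[nhds p \<times>\<^sub>F nhds p](\<lambda>(u, v). norm (u - v))"
proof -
  have "(\<lambda>x. (case x of (u, v) \<Rightarrow> f u - f v - f' (u - v)) + (case x of (u, v) \<Rightarrow> f' (u - v)))
      \<in> O[nhds p \<times>\<^sub>F nhds p](\<lambda>(u, v). norm (u - v))"
    using assms bounded_linear_diff_bigo[of f' "nhds p \<times>\<^sub>F nhds p"]
    unfolding has_strict_derivative_def
    by (intro sum_in_bigo) (auto intro: landau_o.small_imp_big)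
  then show ?thesis
    by (simp add: case_prod_unfold)
qed

lemma has_strict_derivative_lipschitz:
  assumes "has_strict_derivative f f' p"
  shows "\<exists>L>0. \<forall>\<^sub>F (u, v) in nhds p \<times>\<^sub>F nhds p. \<bar>f u - f v\<bar> \<le> L * norm (u - v)"
  using has_strict_derivative_diff_bigo[OF assms]
  by (auto elim!: landau_o.bigE simp: case_prod_unfold)

lemma has_strict_derivative_isCont:
  assumes "has_strict_derivative f f' p"
  shows "isCont f p"
proof -
  obtain L where L: "L > 0"
    "\<forall>\<^sub>F (u, v) in nhds p \<times>\<^sub>F nhds p. \<bar>f u - f v\<bar> \<le> L * norm (u - v)"
    using has_strict_derivative_lipschitz[OF assms] by blast
  then obtain Q where Q: "eventually Q (nhds p)"
    "\<And>u v. Q u \<Longrightarrow> Q v \<Longrightarrow> \<bar>f u - f v\<bar> \<le> L * norm (u - v)"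
    unfolding eventually_prod_same by auto
  have "Q p"
    using Q(1) by (rule eventually_nhds_x_imp_x)
  have "\<forall>\<^sub>F u in at p. norm (f u - f p) \<le> L * norm (u - p)"
    unfolding eventually_at_filter using Q(1) by eventually_elim (use Q(2) \<open>Q p\<close> in auto)
  moreover have "((\<lambda>u. L * norm (u - p)) \<longlongrightarrow> 0) (at p)"
    by (auto intro!: tendsto_eq_intros)
  ultimately show ?thesis
    unfolding isCont_def by (rule LIM_zero_cancel[OF Lim_null_comparison])
qed

text \<open>Both slots of the product filter tend to \<open>p\<close> independently. In the product
  and quotient rules a coefficient taken at either point may therefore be replaced by its value at
  \<open>p\<close>, at the price of a vanishing factor.\<close>

lemma tendsto_nhds_prod:
  fixes f :: "'a::t2_space \<Rightarrow> 'b::topological_space"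
  assumes "isCont f p"
  shows "((\<lambda>x. f (fst x)) \<longlongrightarrow> f p) (nhds p \<times>\<^sub>F nhds p)"
    and "((\<lambda>x. f (snd x)) \<longlongrightarrow> f p) (nhds p \<times>\<^sub>F nhds p)"
proof -
  have "filterlim f (nhds (f p)) (nhds p)"
    using assms by (simp add: isCont_def tendsto_at_iff_tendsto_nhds)
  then show "((\<lambda>x. f (fst x)) \<longlongrightarrow> f p) (nhds p \<times>\<^sub>F nhds p)"
    "((\<lambda>x. f (snd x)) \<longlongrightarrow> f p) (nhds p \<times>\<^sub>F nhds p)"
    by (auto intro: filterlim_compose filterlim_fst filterlim_snd)
qed

lemma tendsto_bigo_1: "(f \<longlongrightarrow> (l::real)) F \<Longrightarrow> f \<in> O[F](\<lambda>_. 1)"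
  by (rule bigoI_tendsto[of _ _ l]) auto

lemma tendsto_diff_smallo_1: "(f \<longlongrightarrow> (l::real)) F \<Longrightarrow> (\<lambda>x. f x - l) \<in> o[F](\<lambda>_. 1)"
  by (rule smalloI_tendsto) (auto simp: LIM_zero)

section \<open>Calculus of strict derivatives\<close>

lemma has_strict_derivative_add:
  assumes "has_strict_derivative f f' p" "has_strict_derivative g g' p"
  shows "has_strict_derivative (\<lambda>x. f x + g x) (\<lambda>h. f' h + g' h) p"
proof -
  have "(\<lambda>x. (case x of (u, v) \<Rightarrow> f u - f v - f' (u - v)) + (case x of (u, v) \<Rightarrow> g u - g v - g' (u - v)))
      \<in> o[nhds p \<times>\<^sub>F nhds p](\<lambda>(u, v). norm (u - v))"
    using assms unfolding has_strict_derivative_def by (intro sum_in_smallo) auto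
  then show ?thesis
    using assms unfolding has_strict_derivative_def
    by (auto intro: bounded_linear_add simp: case_prod_unfold algebra_simps)
qed

text \<open>Telescope \<open>f u * g u - f v * g v\<close> as
  \<open>f u * (g u - g v) + g v * (f u - f v)\<close>. Each product splits into a bounded factor
  times a linearisation error and a vanishing factor times a linear term of order
  \<open>norm (u - v)\<close>; these are the four estimates.\<close>

lemma has_strict_derivative_mult:
  assumes f: "has_strict_derivative f f' p" and g: "has_strict_derivative g g' p"
  shows "has_strict_derivative (\<lambda>x. f x * g x) (\<lambda>h. f p * g' h + f' h * g p) p"
proof -
  let ?F = "nhds p \<times>\<^sub>F nhds p" and ?n = "\<lambda>(u, v). norm (u - v)"
  note lim = tendsto_nhds_prod[OF has_strict_derivative_isCont[OF f]]
    tendsto_nhds_prod[OF has_strict_derivative_isCont[OF g]]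
  have blf: "bounded_linear f'" and blg: "bounded_linear g'"
    using f g by (auto simp: has_strict_derivative_def)
  have 1: "(\<lambda>x. f (fst x) * (case x of (u, v) \<Rightarrow> g u - g v - g' (u - v))) \<in> o[?F](\<lambda>x. 1 * ?n x)"
    using g lim(1) unfolding has_strict_derivative_def
    by (intro landau_o.big_small_mult tendsto_bigo_1) auto
  have 2: "(\<lambda>x. (f (fst x) - f p) * (case x of (u, v) \<Rightarrow> g' (u - v))) \<in> o[?F](\<lambda>x. 1 * ?n x)"
    by (intro landau_o.small_big_mult bounded_linear_diff_bigo blg tendsto_diff_smallo_1 lim)
  have 3: "(\<lambda>x. g (snd x) * (case x of (u, v) \<Rightarrow> f u - f v - f' (u - v))) \<in> o[?F](\<lambda>x. 1 * ?n x)"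
    using f lim(4) unfolding has_strict_derivative_def
    by (intro landau_o.big_small_mult tendsto_bigo_1) auto
  have 4: "(\<lambda>x. (g (snd x) - g p) * (case x of (u, v) \<Rightarrow> f' (u - v))) \<in> o[?F](\<lambda>x. 1 * ?n x)"
    by (intro landau_o.small_big_mult bounded_linear_diff_bigo blf tendsto_diff_smallo_1 lim)
  have "(\<lambda>(u, v). f u * g u - f v * g v - (f p * g' (u - v) + f' (u - v) * g p)) \<in> o[?F](?n)"
    using sum_in_smallo(1)[OF sum_in_smallo(1)[OF 1 2] sum_in_smallo(1)[OF 3 4]]
    by (simp add: case_prod_unfold algebra_simps)
  then show ?thesis
    unfolding has_strict_derivative_def
    by (auto intro!: bounded_linear_add bounded_linear_const_mult bounded_linear_mult_const blf blg)
qed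

lemma has_strict_derivative_const: "has_strict_derivative (\<lambda>x. c) (\<lambda>h. 0) p"
  by (simp add: has_strict_derivative_def case_prod_unfold)

lemma has_strict_derivative_minus:
  assumes "has_strict_derivative f f' p"
  shows "has_strict_derivative (\<lambda>x. - f x) (\<lambda>h. - f' h) p"
  using has_strict_derivative_mult[OF has_strict_derivative_const[of "-1"] assms] by simp

text \<open>The identity 1/f(u) - 1/f(v) = -(f(u) - f(v)) / (f(u) f(v)) reduces the claim to the
  convergence of the coefficient to 1/f(p)^2. It is valid where both values are nonzero, hence
  eventually.\<close>

lemma has_strict_derivative_inverse:
  assumes f: "has_strict_derivative f f' p" and nz: "f p \<noteq> 0"
  shows "has_strict_derivative (\<lambda>x. inverse (f x)) (\<lambda>h. - (f' h / (f p)\<^sup>2)) p"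
proof -
  let ?F = "nhds p \<times>\<^sub>F nhds p" and ?n = "\<lambda>(u, v). norm (u - v)"
  note lim = tendsto_nhds_prod[OF has_strict_derivative_isCont[OF f]]
  have bl: "bounded_linear f'"
    using f by (auto simp: has_strict_derivative_def)
  have lim2: "((\<lambda>x. inverse (f (fst x) * f (snd x))) \<longlongrightarrow> inverse (f p * f p)) ?F"
    by (intro tendsto_inverse tendsto_mult lim) (use nz in auto)
  have 1: "(\<lambda>x. inverse (f (fst x) * f (snd x)) * (case x of (u, v) \<Rightarrow> f u - f v - f' (u - v)))
      \<in> o[?F](\<lambda>x. 1 * ?n x)"
    using f lim2 unfolding has_strict_derivative_def
    by (intro landau_o.big_small_mult tendsto_bigo_1) auto
  have 2: "(\<lambda>x. (inverse (f (fst x) * f (snd x)) - inverse (f p * f p)) *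
      (case x of (u, v) \<Rightarrow> f' (u - v))) \<in> o[?F](\<lambda>x. 1 * ?n x)"
    by (intro landau_o.small_big_mult bounded_linear_diff_bigo bl tendsto_diff_smallo_1 lim2)
  have "\<forall>\<^sub>F x in ?F. f (fst x) \<noteq> 0" "\<forall>\<^sub>F x in ?F. f (snd x) \<noteq> 0"
    using lim nz tendsto_imp_eventually_ne by blast+
  then have "\<forall>\<^sub>F x in ?F.
      inverse (f (fst x) * f (snd x)) * (case x of (u, v) \<Rightarrow> f u - f v - f' (u - v)) +
      (inverse (f (fst x) * f (snd x)) - inverse (f p * f p)) * (case x of (u, v) \<Rightarrow> f' (u - v)) =
      - (case x of (u, v) \<Rightarrow> inverse (f u) - inverse (f v) - - (f' (u - v) / (f p)\<^sup>2))"
    by eventually_elim (use nz in \<open>simp add: case_prod_unfold field_simps power2_eq_square\<close>)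
  from iffD1[OF landau_o.small.in_cong[OF this] sum_in_smallo(1)[OF 1 2]]
  have "(\<lambda>x. - (case x of (u, v) \<Rightarrow> inverse (f u) - inverse (f v) - - (f' (u - v) / (f p)\<^sup>2)))
      \<in> o[?F](?n)"
    by simp
  then show ?thesis
    unfolding has_strict_derivative_def
    using bounded_linear_const_mult[OF bl, of "- inverse ((f p)\<^sup>2)"]
    by (auto simp: divide_inverse mult.commute simp del: minus_diff_eq)
qed

text \<open>Mean value inequality on a ball on which the derivative stays within \<open>e\<close> of
  the derivative at \<open>p\<close>. Any two points of the ball are joined by a segment inside it,
  so neither of them has to be \<open>p\<close>.\<close>

lemma C1_has_strict_derivative:
  fixes f :: "'a::euclidean_space \<Rightarrow> real"
  assumes U: "open U" "p \<in> U"
    and diff: "\<And>z. z \<in> U \<Longrightarrow> f differentiable (at z)"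
    and cont: "\<And>b. b \<in> Basis \<Longrightarrow> continuous_on U (\<lambda>z. frechet_derivative f (at z) b)"
  shows "has_strict_derivative f (frechet_derivative f (at p)) p"
  unfolding has_strict_derivative_def
proof
  have der: "(f has_derivative frechet_derivative f (at z)) (at z)" if "z \<in> U" for z
    using diff[OF that] frechet_derivative_works by blast
  show "bounded_linear (frechet_derivative f (at p))"
    using der[OF U(2)] by (rule has_derivative_bounded_linear)
  show "(\<lambda>(u, v). f u - f v - frechet_derivative f (at p) (u - v))
      \<in> o[nhds p \<times>\<^sub>F nhds p](\<lambda>(u, v). norm (u - v))"
  proof (rule landau_o.smallI)
    fix e :: real assume e: "e > 0"
    \<comment> \<open>The sum over the basis dominates the operator norm of the difference of the
      two derivatives, so continuity of the partial derivatives suffices;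
      \<open>S p = 0\<close>.\<close>
    define S where "S z = (\<Sum>b\<in>Basis. \<bar>frechet_derivative f (at z) b - frechet_derivative f (at p) b\<bar>)" for z
    have "continuous_on U S"
      unfolding S_def by (intro continuous_intros cont)
    then have "(S \<longlongrightarrow> S p) (nhds p)"
      using U by (metis continuous_on_eq_continuous_at isCont_def tendsto_at_iff_tendsto_nhds)
    then have "\<forall>\<^sub>F z in nhds p. S z < e"
      using order_tendstoD(2)[of S "S p" "nhds p" e] e by (auto simp: S_def)
    moreover have "\<forall>\<^sub>F z in nhds p. z \<in> U"
      using U by (rule eventually_nhds_in_open)
    ultimately have "\<forall>\<^sub>F z in nhds p. S z < e \<and> z \<in> U"
      by eventually_elim auto
    then obtain d where d: "d > 0" "\<And>z. z \<in> ball p d \<Longrightarrow> S z < e" "ball p d \<subseteq> U"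
      unfolding eventually_nhds_metric by (auto simp: dist_commute subset_eq)
    have on: "onorm (\<lambda>h. frechet_derivative f (at z) h - frechet_derivative f (at p) h) \<le> e"
      if z: "z \<in> ball p d" for z
    proof (rule onorm_le)
      fix h
      have lin: "linear (\<lambda>h. frechet_derivative f (at z) h - frechet_derivative f (at p) h)"
        using der[OF U(2)] der[OF subsetD[OF d(3) z]]
        by (intro linear_compose_sub) (auto dest: has_derivative_linear)
      have "frechet_derivative f (at z) h - frechet_derivative f (at p) h =
        (\<Sum>b\<in>Basis. (h \<bullet> b) * (frechet_derivative f (at z) b - frechet_derivative f (at p) b))"
        using Linear_Algebra.linear_componentwise[OF lin, of h 1] by simp
      also have "norm \<dots> \<le> (\<Sum>b\<in>Basis. norm h * \<bar>frechet_derivative f (at z) b - frechet_derivative f (at p) b\<bar>)"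
        by (intro sum_norm_le) (auto simp: abs_mult Basis_le_norm intro!: mult_right_mono)
      also have "\<dots> = S z * norm h"
        by (simp add: S_def sum_distrib_left mult.commute)
      also have "\<dots> \<le> e * norm h"
        using d(2)[OF z] by (intro mult_right_mono) auto
      finally show "norm (frechet_derivative f (at z) h - frechet_derivative f (at p) h) \<le> e * norm h" .
    qed
    have "norm (f u - f v - frechet_derivative f (at p) (u - v)) \<le> norm (u - v) * e"
      if "u \<in> ball p d" "v \<in> ball p d" for u v
    proof (rule differentiable_bound_linearization[where S = "ball p d"])
      show "v + t *\<^sub>R (u - v) \<in> ball p d" if t: "t \<in> {0..1}" for t
        using convexD_alt[OF convex_ball \<open>v \<in> ball p d\<close> \<open>u \<in> ball p d\<close>, of t] t
        by (simp add: algebra_simps)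
      show "(f has_derivative frechet_derivative f (at z)) (at z within ball p d)"
        if "z \<in> ball p d" for z
        using der that d(3) by (blast intro: has_derivative_at_withinI)
    qed (use on d(1) in \<open>auto simp: fun_diff_def\<close>)
    moreover have "\<forall>\<^sub>F u in nhds p. u \<in> ball p d"
      using d(1) by (intro eventually_nhds_in_open) auto
    ultimately show "\<forall>\<^sub>F x in nhds p \<times>\<^sub>F nhds p.
        norm (case x of (u, v) \<Rightarrow> f u - f v - frechet_derivative f (at p) (u - v))
        \<le> e * norm (case x of (u, v) \<Rightarrow> norm (u - v))"
      unfolding eventually_prod_same by (intro exI[of _ "\<lambda>u. u \<in> ball p d"]) (auto simp: mult.commute)
  qed
qed

section \<open>Functions with finite C^k norm\<close>

lemma finite_Ck_norm_continuous_on: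
  "finite_Ck_norm k f U \<Longrightarrow> continuous_on U f"
  by (cases k) (auto intro!: continuous_at_imp_continuous_on differentiable_imp_continuous_within)

lemma finite_Ck_norm_SucD:
  assumes "finite_Ck_norm (Suc k) f U"
  shows "\<And>z. z \<in> U \<Longrightarrow> (f has_derivative frechet_derivative f (at z)) (at z)"
    and "\<And>b. b \<in> Basis \<Longrightarrow> finite_Ck_norm k (\<lambda>z. frechet_derivative f (at z) b) U"
  using assms by (auto simp: frechet_derivative_works)

lemma finite_Ck_norm_has_strict_derivative:
  assumes "finite_Ck_norm (Suc k) f U" "open U" "p \<in> U"
  shows "has_strict_derivative f (frechet_derivative f (at p)) p"
  using assms by (intro C1_has_strict_derivative[of U]) (auto intro: finite_Ck_norm_continuous_on)

section \<open>Bilipschitz families are cinematic\<close>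

text \<open>The lower bound puts a \<open>d\<close>-ball of radius \<open>r\<close> inside the image
  of a Euclidean ball of radius r/c. Rescaling by c/r turns that into the unit ball, whose finite
  cover depends neither on \<open>u\<close> nor on \<open>r\<close>; the upper bound carries the
  cover back.\<close>

lemma doubling_constant_bilipschitz:
  fixes g :: "'b::euclidean_space \<Rightarrow> 'a"
  assumes c: "c > 0"
    and lower: "\<And>z z'. z \<in> Z \<Longrightarrow> z' \<in> Z \<Longrightarrow> c * norm (z - z') \<le> d (g z) (g z')"
    and upper: "\<And>z z'. z \<in> Z \<Longrightarrow> z' \<in> Z \<Longrightarrow> d (g z) (g z') \<le> L * norm (z - z')"
  shows "\<exists>D. doubling_constant_at_most (g ` Z) d D"
proof -
  \<comment> \<open>Two points in one cell of radius \<epsilon> are less than 2 \<epsilon> r / c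
    apart before rescaling, hence their images less than r / 2. The added 1 keeps the denominator
    positive for every real \<open>L\<close>.\<close>
  define \<epsilon> where "\<epsilon> = c / (4 * (\<bar>L\<bar> + 1))"
  have \<epsilon>: "\<epsilon> > 0" "4 * (\<bar>L\<bar> + 1) * \<epsilon> = c"
    using c by (auto simp: \<epsilon>_def)
  obtain N where N: "finite N" "cball (0::'b) 1 \<subseteq> (\<Union>k\<in>N. ball k \<epsilon>)"
    using compact_cball[of "0::'b" 1] \<epsilon>(1) by (auto simp: compact_eq_totally_bounded)
  have "\<exists>C\<subseteq>g ` Z. finite C \<and> card C \<le> card N \<and>
      {z \<in> g ` Z. d (g u) z < r} \<subseteq> (\<Union>q\<in>C. {z \<in> g ` Z. d q z < r / 2})"
    if u: "u \<in> Z" and r: "r > 0" for u r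
  proof -
    \<comment> \<open>The new centres must lie in the family, whereas points of \<open>N\<close>
      need not come from \<open>Z\<close>; so each cell that meets the rescaled \<open>Z\<close>
      contributes one of its own points.\<close>
    define P where "P k z \<longleftrightarrow> z \<in> Z \<and> (c / r) *\<^sub>R (z - u) \<in> ball k \<epsilon>" for k z
    define C where "C = (\<lambda>k. g (SOME z. P k z)) ` {k \<in> N. \<exists>z. P k z}"
    have P_some: "P k (SOME z. P k z)" if "P k z" for k z
      using that by (rule someI)
    have "C \<subseteq> g ` Z"
    proof
      fix q assume "q \<in> C"
      then obtain k z where "q = g (SOME z. P k z)" "P k z"
        unfolding C_def by auto
      then show "q \<in> g ` Z"
        using P_some[of k z] by (auto simp: P_def[of k "SOME z. P k z"])
    qed
    moreover have "finite C" "card C \<le> card N"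
      unfolding C_def using N(1) card_mono[of N "{k \<in> N. \<exists>z. P k z}"]
      by (auto intro: order.trans[OF card_image_le])
    moreover have "\<exists>q\<in>C. d q (g z) < r / 2" if z: "z \<in> Z" "d (g u) (g z) < r" for z
    proof -
      have "c * norm (z - u) < r"
        using lower[OF u z(1)] z(2) by (simp add: norm_minus_commute)
      then have "(c / r) *\<^sub>R (z - u) \<in> cball 0 1"
        using c r by simp
      then obtain k where k: "k \<in> N" "P k z"
        using N(2) z(1) unfolding P_def by blast
      define v where "v = (SOME z. P k z)"
      have v: "P k v"
        unfolding v_def by (rule P_some[OF k(2)])
      have "c / r * norm (v - z) = norm ((c / r) *\<^sub>R (v - z))"
        using c r by simp
      also have "\<dots> = dist ((c / r) *\<^sub>R (v - u)) ((c / r) *\<^sub>R (z - u))"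
        by (simp add: dist_norm scaleR_diff_right)
      also have "\<dots> < 2 * \<epsilon>"
        using v k(2) dist_triangle_half_l[of _ k "2 * \<epsilon>"] by (simp add: P_def dist_commute)
      finally have "c * norm (v - z) < 2 * \<epsilon> * r"
        using c r by (simp add: field_simps)
      then have "4 * (\<bar>L\<bar> + 1) * \<epsilon> * norm (v - z) < 2 * \<epsilon> * r"
        by (simp only: \<epsilon>(2))
      then have "\<epsilon> * (2 * ((\<bar>L\<bar> + 1) * norm (v - z))) < \<epsilon> * r"
        by (simp add: algebra_simps)
      then have "(\<bar>L\<bar> + 1) * norm (v - z) < r / 2"
        using mult_less_cancel_left_pos[OF \<epsilon>(1)] by simp
      moreover have "L * norm (v - z) \<le> (\<bar>L\<bar> + 1) * norm (v - z)"
        by (intro mult_right_mono) auto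
      moreover have "d (g v) (g z) \<le> L * norm (v - z)"
        using v z(1) by (intro upper) (auto simp: P_def)
      ultimately have "d (g v) (g z) < r / 2"
        by linarith
      moreover have "g v \<in> C"
        using k unfolding C_def v_def by auto
      ultimately show ?thesis ..
    qed
    ultimately show ?thesis
      by (intro exI[of _ C]) blast
  qed
  then show ?thesis
    unfolding doubling_constant_at_most_def by blast
qed

section \<open>The C^2 distance on a compact interval\<close>

lemma has_real_derivative_imp_differentiable_on:
  "(\<And>t. t \<in> S \<Longrightarrow> (f has_real_derivative f' t) (at t within S)) \<Longrightarrow> f differentiable_on S"
  unfolding differentiable_on_def real_differentiable_def by blast

lemma D1_eq:
  assumes "a < b" "t \<in> {a..b}" "(f has_real_derivative f') (at t within {a..b})"
  shows "D1 {a..b} f t = f'"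
  unfolding D1_def using assms
  by (intro vector_derivative_within)
     (auto simp: has_real_derivative_iff_has_vector_derivative[symmetric] trivial_limit_within)

lemma D1_has_derivative:
  assumes "f differentiable_on {a..b}" "t \<in> {a..b}"
  shows "(f has_real_derivative D1 {a..b} f t) (at t within {a..b})"
  using assms vector_derivative_works[of f "at t within {a..b}"]
  by (auto simp: D1_def differentiable_on_def has_real_derivative_iff_has_vector_derivative)

lemma D1_diff:
  assumes "a < b" "t \<in> {a..b}" "f differentiable_on {a..b}" "g differentiable_on {a..b}"
  shows "D1 {a..b} (\<lambda>t. f t - g t) t = D1 {a..b} f t - D1 {a..b} g t"
  using assms by (intro D1_eq) (auto intro!: DERIV_diff D1_has_derivative)

lemma D1_cong:
  assumes "a < b" "t \<in> {a..b}" "f differentiable_on {a..b}"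
    and "\<And>s. s \<in> {a..b} \<Longrightarrow> g s = f s"
  shows "D1 {a..b} g t = D1 {a..b} f t"
proof (rule D1_eq[OF assms(1,2)])
  show "(g has_real_derivative D1 {a..b} f t) (at t within {a..b})"
    by (rule has_field_derivative_transform_within[OF D1_has_derivative[OF assms(3,2)], of 1])
       (use assms in auto)
qed

lemma D2_diff:
  assumes "a < b" "t \<in> {a..b}" "f \<in> C2_space {a..b}" "g \<in> C2_space {a..b}"
  shows "D2 {a..b} (\<lambda>t. f t - g t) t = D2 {a..b} f t - D2 {a..b} g t"
proof -
  have diff: "f differentiable_on {a..b}" "g differentiable_on {a..b}"
    "D1 {a..b} f differentiable_on {a..b}" "D1 {a..b} g differentiable_on {a..b}"
    using assms by (auto simp: C2_space_def)
  have "D2 {a..b} (\<lambda>t. f t - g t) t = D1 {a..b} (\<lambda>t. D1 {a..b} f t - D1 {a..b} g t) t"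
    unfolding D2_def using assms diff
    by (intro D1_cong) (auto intro!: D1_diff derivative_intros)
  also have "\<dots> = D2 {a..b} f t - D2 {a..b} g t"
    unfolding D2_def using assms diff by (intro D1_diff)
  finally show ?thesis .
qed

lemma C2_dist_eq:
  assumes "a < b" "f \<in> C2_space {a..b}" "g \<in> C2_space {a..b}"
  shows "C2_dist {a..b} f g = (SUP t\<in>{a..b}. \<bar>f t - g t\<bar>) +
    (SUP t\<in>{a..b}. \<bar>D1 {a..b} f t - D1 {a..b} g t\<bar>) +
    (SUP t\<in>{a..b}. \<bar>D2 {a..b} f t - D2 {a..b} g t\<bar>)"
  unfolding C2_dist_def C2_norm_def using assms
  by (intro arg_cong2[where f = "(+)"] SUP_cong refl)
     (auto simp: D2_diff intro!: arg_cong[where f = abs] D1_diff simp: C2_space_def)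

lemma pointwise_C2_diff_le_C2_dist:
  assumes "a < b" "f \<in> C2_space {a..b}" "g \<in> C2_space {a..b}" "t \<in> {a..b}"
  shows "pointwise_C2_diff {a..b} f g t \<le> C2_dist {a..b} f g"
proof -
  have bdd: "bdd_above ((\<lambda>t. \<bar>h t - k t\<bar>) ` {a..b})"
    if "continuous_on {a..b} h" "continuous_on {a..b} k" for h k :: "real \<Rightarrow> real"
    using that by (intro bounded_imp_bdd_above compact_imp_bounded compact_continuous_image continuous_intros)
       auto
  show ?thesis
    unfolding C2_dist_eq[OF assms(1-3)] pointwise_C2_diff_def using assms
    by (intro add_mono cSUP_upper bdd)
       (auto simp: C2_space_def intro: differentiable_imp_continuous_on)
qed

text \<open>The pointwise lower bound serves twice: it makes the parametrisation bilipschitz, so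
  that the image is doubling, and it gives the cinematic inequality, because the C^2 distance and
  the jet difference at any \<open>t\<close> are both comparable to
  \<open>norm (z - z')\<close>.\<close>

lemma cinematic_family_param:
  fixes g :: "'b::euclidean_space \<Rightarrow> real \<Rightarrow> real"
  assumes ab: "a < b" and c: "c > 0" and "bounded Z"
    and C2: "\<And>z. z \<in> Z \<Longrightarrow> g z \<in> C2_space {a..b}"
    and lower: "\<And>z z' t. z \<in> Z \<Longrightarrow> z' \<in> Z \<Longrightarrow> t \<in> {a..b} \<Longrightarrow>
      c * norm (z - z') \<le> pointwise_C2_diff {a..b} (g z) (g z') t"
    and upper: "\<And>z z' t. z \<in> Z \<Longrightarrow> z' \<in> Z \<Longrightarrow> t \<in> {a..b} \<Longrightarrow>
      pointwise_C2_diff {a..b} (g z) (g z') t \<le> L * norm (z - z')"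
  shows "\<exists>K D. cinematic_family {a..b} K D (g ` Z)"
proof -
  \<comment> \<open>One summand for each of the three suprema in the norm.\<close>
  define L' where "L' = 3 * (\<bar>L\<bar> + 1)"
  have L': "L' > 0"
    by (auto simp: L'_def)
  have dist_upper: "C2_dist {a..b} (g z) (g z') \<le> L' * norm (z - z')" if "z \<in> Z" "z' \<in> Z" for z z'
  proof -
    have le: "pointwise_C2_diff {a..b} (g z) (g z') t \<le> (\<bar>L\<bar> + 1) * norm (z - z')"
      if "t \<in> {a..b}" for t
      by (rule order.trans[OF upper[OF \<open>z \<in> Z\<close> \<open>z' \<in> Z\<close> that]]) (intro mult_right_mono, auto)
    have "C2_dist {a..b} (g z) (g z') \<le> (\<bar>L\<bar> + 1) * norm (z - z') +
        (\<bar>L\<bar> + 1) * norm (z - z') + (\<bar>L\<bar> + 1) * norm (z - z')"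
      unfolding C2_dist_eq[OF ab C2[OF \<open>z \<in> Z\<close>] C2[OF \<open>z' \<in> Z\<close>]]
      by (intro add_mono cSUP_least order.trans[OF _ le]) (use ab in \<open>auto simp: pointwise_C2_diff_def\<close>)
    then show ?thesis
      by (simp add: L'_def algebra_simps)
  qed
  have dist_lower: "c * norm (z - z') \<le> C2_dist {a..b} (g z) (g z')" if "z \<in> Z" "z' \<in> Z" for z z'
    using lower[OF that, of a] pointwise_C2_diff_le_C2_dist[OF ab C2[OF that(1)] C2[OF that(2)], of a] ab
    by auto
  obtain D where D: "doubling_constant_at_most (g ` Z) (C2_dist {a..b}) D"
    using doubling_constant_bilipschitz[OF c, of Z "C2_dist {a..b}" g L'] dist_upper dist_lower by blast
  obtain M where M: "\<And>z. z \<in> Z \<Longrightarrow> norm z \<le> M"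
    using \<open>bounded Z\<close> by (auto simp: bounded_iff)
  \<comment> \<open>The first entry serves the cinematic lower bound through
    \<open>L' \<le> c * K\<close>; the second bounds the diameter, as two points of \<open>Z\<close>
    are at most \<open>2 * M\<close> apart.\<close>
  define K where "K = max (L' / c) (L' * (2 * M))"
  have "L' / c \<le> K" "0 < L' / c"
    using L' c by (auto simp: K_def)
  moreover from this have "K > 0"
    by linarith
  ultimately have K: "K > 0" "L' \<le> c * K"
    using c by (simp_all add: field_simps)
  have "C2_dist {a..b} (g z) (g z') \<le> K" if "z \<in> Z" "z' \<in> Z" for z z'
  proof -
    have "norm (z - z') \<le> 2 * M"
      using norm_triangle_ineq4[of z z'] M[OF that(1)] M[OF that(2)] by linarith
    then have "L' * norm (z - z') \<le> L' * (2 * M)"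
      using L' by (intro mult_left_mono) auto
    then show ?thesis
      using dist_upper[OF that] by (simp add: K_def)
  qed
  moreover have "inverse K * C2_dist {a..b} (g z) (g z') \<le>
      (INF t\<in>{a..b}. pointwise_C2_diff {a..b} (g z) (g z') t)" if z: "z \<in> Z" "z' \<in> Z" for z z'
  proof (rule cINF_greatest)
    fix t assume t: "t \<in> {a..b}"
    have "C2_dist {a..b} (g z) (g z') \<le> L' * norm (z - z')"
      by (rule dist_upper[OF z])
    also have "\<dots> \<le> c * K * norm (z - z')"
      by (rule mult_right_mono[OF K(2)]) auto
    also have "\<dots> \<le> K * pointwise_C2_diff {a..b} (g z) (g z') t"
      using mult_left_mono[OF lower[OF z t], of K] K(1) by (simp add: mult_ac)
    finally show "inverse K * C2_dist {a..b} (g z) (g z') \<le> pointwise_C2_diff {a..b} (g z) (g z') t"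
      using K(1) by (simp add: field_simps)
  qed (use ab in auto)
  ultimately show ?thesis
    unfolding cinematic_family_def using K(1) D C2 by blast
qed

section \<open>Level curves as solutions of \<open>f' = q(t, f, y)\<close>\<close>

text \<open>The quantitative situation near 0, freed from the formulas for \<open>q\<close> and
  \<open>w\<close>. The vector \<open>(1, q p, 0)\<close> is tangent to the level set of \<Phi> at
  fixed \<open>y\<close>, so \<open>q\<close> is the slope of the curve and \<open>w\<close> the
  derivative of that slope along it. In \<open>jet_lower\<close> the two points share their first
  coordinate, since curves are compared at one abscissa.\<close>

locale level_curves =
  fixes \<Phi> q w :: "real \<times> real \<times> 'b::euclidean_space \<Rightarrow> real" and \<rho> L c :: real
  assumes pos: "\<rho> > 0" "L > 0" "c > 0"
    and \<Phi>_0: "\<Phi> 0 = 0"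
    and deriv_\<Phi>: "\<And>p. p \<in> ball 0 \<rho> \<Longrightarrow>
      \<exists>\<Phi>'. (\<Phi> has_derivative \<Phi>') (at p) \<and> \<Phi>' (1, q p, 0) = 0 \<and> \<Phi>' (0, 1, 0) \<noteq> 0"
    and deriv_q: "\<And>p. p \<in> ball 0 \<rho> \<Longrightarrow> \<exists>q'. (q has_derivative q') (at p) \<and> q' (1, q p, 0) = w p"
    and cont_w: "continuous_on (ball 0 \<rho>) w"
    and lipschitz:
      "\<And>u v. u \<in> ball 0 \<rho> \<Longrightarrow> v \<in> ball 0 \<rho> \<Longrightarrow> \<bar>\<Phi> u - \<Phi> v\<bar> \<le> L * norm (u - v)"
      "\<And>u v. u \<in> ball 0 \<rho> \<Longrightarrow> v \<in> ball 0 \<rho> \<Longrightarrow> \<bar>q u - q v\<bar> \<le> L * norm (u - v)"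
      "\<And>u v. u \<in> ball 0 \<rho> \<Longrightarrow> v \<in> ball 0 \<rho> \<Longrightarrow> \<bar>w u - w v\<bar> \<le> L * norm (u - v)"
    and increasing: "\<And>t x x' y. (t, x, y) \<in> ball 0 \<rho> \<Longrightarrow> (t, x', y) \<in> ball 0 \<rho> \<Longrightarrow> x < x' \<Longrightarrow>
      (x' - x) / 2 \<le> \<Phi> (t, x', y) - \<Phi> (t, x, y)"
    and jet_lower: "\<And>t x x' y y'. (t, x, y) \<in> ball 0 \<rho> \<Longrightarrow> (t, x', y') \<in> ball 0 \<rho> \<Longrightarrow>
      c * norm (y - y') \<le> \<bar>x - x'\<bar> + \<bar>q (t, x, y) - q (t, x', y')\<bar> + \<bar>w (t, x, y) - w (t, x', y')\<bar>"
begin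

text \<open>Three coordinates of size \<sigma> fit into the ball of radius \<rho>. By
  \<open>increasing\<close>, \<Phi> (0, s, 0) is at least \<sigma>/2 at s = \<sigma> and at most
  -\<sigma>/2 at s = -\<sigma>. With \<delta> \<le> \<sigma>/(8 L), moving \<open>(t, y)\<close>
  away from 0 changes these values by at most \<sigma>/4, so the levels in \<open>Rlev\<close> stay
  strictly between them.\<close>

definition "\<sigma> = \<rho> / 4"
definition "\<delta> = min \<sigma> (\<sigma> / (8 * L))"
definition "Ylev = ball (0::'b) \<delta>"
definition "Rlev = {-\<sigma>/4<..<\<sigma>/4}"
text \<open>The bound by \<sigma> confines \<open>x\<close> to the range where \<Phi> is known to
  increase, and \<open>restrict\<close> supplies the extensionality that \<open>C2_space\<close>
  asks for.\<close>

definition height :: "'b \<Rightarrow> real \<Rightarrow> real \<Rightarrow> real" where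
  "height y r = restrict (\<lambda>t. THE x. \<bar>x\<bar> < \<sigma> \<and> \<Phi> (t, x, y) = r) {-\<delta>..\<delta>}"

lemma \<sigma>_pos: "\<sigma> > 0" and \<delta>_pos: "\<delta> > 0"
  using pos by (auto simp: \<sigma>_def \<delta>_def)

lemma norm_triple_le: "norm (t::real, x::real, y::'b) \<le> \<bar>t\<bar> + \<bar>x\<bar> + norm y"
  using norm_Pair_le[of t "(x, y)"] norm_Pair_le[of x y] by simp

lemma in_ball:
  assumes "\<bar>t\<bar> \<le> \<delta>" "\<bar>x\<bar> \<le> \<sigma>" "y \<in> Ylev"
  shows "(t, x, y) \<in> ball 0 \<rho>"
proof -
  have "\<bar>t\<bar> + \<bar>x\<bar> + norm y < 3 * \<sigma>"
    using assms \<sigma>_pos by (auto simp: Ylev_def \<delta>_def)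
  then show ?thesis
    using norm_triple_le[of t x y] pos by (simp add: \<sigma>_def)
qed

lemma height_unique:
  assumes "\<bar>t\<bar> \<le> \<delta>" "y \<in> Ylev" "\<bar>x\<bar> < \<sigma>" "\<bar>x'\<bar> < \<sigma>" "\<Phi> (t, x, y) = \<Phi> (t, x', y)"
  shows "x = x'"
proof -
  have "(t, x, y) \<in> ball 0 \<rho>" "(t, x', y) \<in> ball 0 \<rho>"
    by (intro in_ball; use assms in simp)+
  from increasing[OF this] increasing[OF this(2,1)] show ?thesis
    using assms(5) by (cases x x' rule: linorder_cases) simp_all
qed

lemma height_exists:
  assumes "\<bar>t\<bar> \<le> \<delta>" "y \<in> Ylev" "r \<in> Rlev"
  shows "\<exists>x. \<bar>x\<bar> < \<sigma> \<and> \<Phi> (t, x, y) = r"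
proof -
  have 0: "\<bar>0\<bar> \<le> \<delta>" "0 \<in> Ylev"
    using \<delta>_pos by (auto simp: Ylev_def)
  have close: "\<bar>\<Phi> (t, s, y) - \<Phi> (0, s, 0)\<bar> \<le> \<sigma> / 4" if s: "\<bar>s\<bar> \<le> \<sigma>" for s
  proof -
    have "\<bar>\<Phi> (t, s, y) - \<Phi> (0, s, 0)\<bar> \<le> L * norm ((t, s, y) - (0, s, 0))"
      using assms s 0 by (intro lipschitz in_ball)
    also have "\<dots> \<le> L * (2 * \<delta>)"
      using norm_triple_le[of t 0 y] assms pos by (intro mult_left_mono) (auto simp: Ylev_def)
    also have "\<dots> \<le> L * (2 * (\<sigma> / (8 * L)))"
      using pos by (intro mult_left_mono) (auto simp: \<delta>_def)
    also have "\<dots> = \<sigma> / 4"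
      using pos by simp
    finally show ?thesis .
  qed
  have "\<Phi> (0, 0, 0) = 0"
    using \<Phi>_0 by (simp add: zero_prod_def)
  then have "\<sigma> / 2 \<le> \<Phi> (0, \<sigma>, 0)" "\<Phi> (0, -\<sigma>, 0) \<le> - \<sigma> / 2"
    using increasing[of 0 0 0 \<sigma>] increasing[of 0 "-\<sigma>" 0 0]
      in_ball[OF 0(1) _ 0(2), of 0] in_ball[OF 0(1) _ 0(2), of \<sigma>] in_ball[OF 0(1) _ 0(2), of "-\<sigma>"] \<sigma>_pos
    by simp_all
  then have ends: "\<Phi> (t, -\<sigma>, y) < r" "r < \<Phi> (t, \<sigma>, y)"
    using close[of \<sigma>] close[of "-\<sigma>"] assms(3) \<sigma>_pos unfolding Rlev_def by (simp_all, linarith+)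
  have "continuous_on {-\<sigma>..\<sigma>} (\<lambda>x. \<Phi> (t, x, y))"
  proof (rule continuous_on_compose2[of "ball 0 \<rho>" \<Phi>])
    show "continuous_on (ball 0 \<rho>) \<Phi>"
      using deriv_\<Phi> by (intro continuous_at_imp_continuous_on ballI) (blast intro: has_derivative_continuous)
    show "(\<lambda>x. (t, x, y)) ` {-\<sigma>..\<sigma>} \<subseteq> ball 0 \<rho>"
      using in_ball assms by auto
  qed (intro continuous_intros)
  then obtain x where x: "-\<sigma> \<le> x" "x \<le> \<sigma>" "\<Phi> (t, x, y) = r"
    using IVT'[of "\<lambda>x. \<Phi> (t, x, y)" "-\<sigma>" r \<sigma>] ends \<sigma>_pos by auto
  then have "x \<noteq> \<sigma>" "x \<noteq> -\<sigma>"
    using ends by auto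
  with x show ?thesis
    by (intro exI[of _ x]) auto
qed

lemma height:
  assumes "t \<in> {-\<delta>..\<delta>}" "y \<in> Ylev" "r \<in> Rlev"
  shows "\<bar>height y r t\<bar> < \<sigma>" "\<Phi> (t, height y r t, y) = r" "(t, height y r t, y) \<in> ball 0 \<rho>"
proof -
  have t: "\<bar>t\<bar> \<le> \<delta>"
    using assms(1) by auto
  have "\<exists>!x. \<bar>x\<bar> < \<sigma> \<and> \<Phi> (t, x, y) = r"
    using height_exists[OF t assms(2,3)] height_unique[OF t assms(2)] by blast
  from theI'[OF this] show *: "\<bar>height y r t\<bar> < \<sigma>" "\<Phi> (t, height y r t, y) = r"
    using assms(1) by (auto simp: height_def)
  show "(t, height y r t, y) \<in> ball 0 \<rho>"
    using * t assms(2) by (intro in_ball) auto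
qed

lemma height_eqI:
  assumes "t \<in> {-\<delta>..\<delta>}" "y \<in> Ylev" "r \<in> Rlev" "\<bar>x\<bar> < \<sigma>" "\<Phi> (t, x, y) = r"
  shows "x = height y r t"
proof (rule height_unique[of t y])
  show "\<Phi> (t, x, y) = \<Phi> (t, height y r t, y)"
    using assms(5) height(2)[OF assms(1-3)] by simp
qed (use assms height(1)[OF assms(1-3)] in auto)

text \<open>\<Phi> grows at least at rate 1/2 in \<open>x\<close>, so a height difference is at most
  twice the difference of \<Phi> at one fixed \<open>y\<close>. Passing through
  \<open>(t, x', y)\<close> trades the change of \<open>y\<close> for a Lipschitz error.\<close>

lemma parameter_upper:
  assumes "\<bar>t\<bar> \<le> \<delta>" "\<bar>x\<bar> \<le> \<sigma>" "\<bar>x'\<bar> \<le> \<sigma>" "y \<in> Ylev" "y' \<in> Ylev"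
  shows "\<bar>x - x'\<bar> \<le> 2 * \<bar>\<Phi> (t, x, y) - \<Phi> (t, x', y')\<bar> + 2 * L * norm (y - y')"
proof -
  have "\<bar>x - x'\<bar> \<le> 2 * \<bar>\<Phi> (t, x, y) - \<Phi> (t, x', y)\<bar>"
    using increasing[of t x y x'] increasing[of t x' y x] in_ball[of t x y] in_ball[of t x' y] assms
    by (cases x x' rule: linorder_cases) auto
  moreover have "\<bar>\<Phi> (t, x', y) - \<Phi> (t, x', y')\<bar> \<le> L * norm (y - y')"
    using lipschitz(1)[OF in_ball[of t x' y] in_ball[of t x' y']] assms by (simp add: norm_Pair)
  moreover have "\<bar>\<Phi> (t, x, y) - \<Phi> (t, x', y)\<bar> \<le>
      \<bar>\<Phi> (t, x, y) - \<Phi> (t, x', y')\<bar> + \<bar>\<Phi> (t, x', y) - \<Phi> (t, x', y')\<bar>"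
    by simp
  moreover have "a \<le> 2 * s + 2 * L * n" if "a \<le> 2 * b" "d \<le> L * n" "b \<le> s + d" for a b d s n :: real
    using that by simp
  ultimately show ?thesis
    by blast
qed

text \<open>Both heights are compared at the abscissa \<open>s\<close>: there \<Phi> at height
  \<open>height y r t\<close> differs from \<open>r\<close> only because the abscissa moved from
  \<open>t\<close>. This a priori bound makes increments along the curve comparable to
  \<open>s - t\<close> before differentiability is known.\<close>

lemma height_lipschitz:
  assumes "s \<in> {-\<delta>..\<delta>}" "t \<in> {-\<delta>..\<delta>}" "y \<in> Ylev" "r \<in> Rlev"
  shows "\<bar>height y r s - height y r t\<bar> \<le> 2 * L * \<bar>s - t\<bar>"
proof -
  let ?h = "height y r"
  note hs = height[OF assms(1,3,4)] and ht = height[OF assms(2,3,4)]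
  have "\<bar>?h s - ?h t\<bar> \<le> 2 * \<bar>\<Phi> (s, ?h s, y) - \<Phi> (s, ?h t, y)\<bar> + 2 * L * norm (y - y)"
    using assms hs ht by (intro parameter_upper) auto
  also have "\<Phi> (s, ?h s, y) = \<Phi> (t, ?h t, y)"
    using hs ht by simp
  also have "\<bar>\<Phi> (t, ?h t, y) - \<Phi> (s, ?h t, y)\<bar> \<le> L * norm ((t, ?h t, y) - (s, ?h t, y))"
    using assms ht by (intro lipschitz in_ball) auto
  also have "norm ((t, ?h t, y) - (s, ?h t, y)) = \<bar>s - t\<bar>"
    by (simp add: norm_Pair abs_minus_commute)
  finally show ?thesis
    by simp
qed

text \<open>As \<Phi> is constant on the curve, its linearisation at \<open>p\<close> is small on
  the increment \<open>u - p\<close>. On vectors without \<open>y\<close> component that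
  linearisation is a nonzero multiple of \<open>l - q p * k\<close>, which is exactly the error of
  the claimed derivative.\<close>

lemma height_has_derivative:
  assumes t: "t \<in> {-\<delta>..\<delta>}" and yr: "y \<in> Ylev" "r \<in> Rlev"
  shows "(height y r has_real_derivative q (t, height y r t, y)) (at t within {-\<delta>..\<delta>})"
proof -
  let ?h = "height y r"
  define p where "p = (t, ?h t, y)"
  obtain \<Phi>' where \<Phi>': "(\<Phi> has_derivative \<Phi>') (at p)" "\<Phi>' (1, q p, 0) = 0" "\<Phi>' (0, 1, 0) \<noteq> 0"
    using deriv_\<Phi> height(3)[OF t yr] unfolding p_def by blast
  define m where "m = \<bar>\<Phi>' (0, 1, 0)\<bar>"
  have m: "m > 0"
    using \<Phi>'(3) by (simp add: m_def)
  have lin: "linear \<Phi>'"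
    using \<Phi>'(1) by (rule has_derivative_linear)
  have along: "\<Phi>' (k, l, 0) = (l - q p * k) * \<Phi>' (0, 1, 0)" for k l
  proof -
    have "(k, l, 0) = k *\<^sub>R (1, q p, 0) + (l - q p * k) *\<^sub>R (0, 1, 0)"
      by (simp add: algebra_simps)
    then have "\<Phi>' (k, l, 0) = \<Phi>' (k *\<^sub>R (1, q p, 0) + (l - q p * k) *\<^sub>R (0, 1, 0))"
      by (rule arg_cong)
    then have "\<Phi>' (k, l, 0) = k *\<^sub>R \<Phi>' (1, q p, 0) + (l - q p * k) *\<^sub>R \<Phi>' (0, 1, 0)"
      by (simp only: linear_add[OF lin] linear_scale[OF lin])
    then show ?thesis
      using \<Phi>'(2) by simp
  qed
  have "(?h has_derivative (\<lambda>k. q p * k)) (at t within {-\<delta>..\<delta>})"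
    unfolding has_derivative_within_alt
  proof (intro conjI allI impI)
    show "bounded_linear (\<lambda>k. q p * k)"
      by (rule bounded_linear_mult_right)
    fix e :: real assume e: "e > 0"
    \<comment> \<open>A Lipschitz constant of the curve as a map into the product space: 1 for the
      abscissa and \<open>2 * L\<close> for the height.\<close>
    define C where "C = 1 + 2 * L"
    have C: "C > 0"
      using pos by (simp add: C_def)
    have "e * m / C > 0"
      using e m C by simp
    then obtain d where d: "d > 0"
      "\<And>u. norm (u - p) < d \<Longrightarrow> norm (\<Phi> u - \<Phi> p - \<Phi>' (u - p)) \<le> e * m / C * norm (u - p)"
      using \<Phi>'(1) unfolding has_derivative_at_alt by blast
    show "\<exists>d>0. \<forall>s\<in>{-\<delta>..\<delta>}. norm (s - t) < d \<longrightarrow>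
        norm (?h s - ?h t - q p * (s - t)) \<le> e * norm (s - t)"
    proof (intro exI[of _ "d / C"] conjI ballI impI)
      show "d / C > 0"
        using d C by simp
      fix s assume s: "s \<in> {-\<delta>..\<delta>}" and near: "norm (s - t) < d / C"
      define u where "u = (s, ?h s, y)"
      have diff: "u - p = (s - t, ?h s - ?h t, 0)"
        by (simp add: u_def p_def)
      have up: "norm (u - p) \<le> C * \<bar>s - t\<bar>"
        using norm_triple_le[of "s - t" "?h s - ?h t" 0] height_lipschitz[OF s t yr]
        by (simp add: diff C_def algebra_simps)
      also have "\<dots> < d"
        using near C by (simp add: field_simps)
      finally have "norm (\<Phi> u - \<Phi> p - \<Phi>' (u - p)) \<le> e * m / C * norm (u - p)"
        by (rule d(2))
      moreover have "\<Phi> u = \<Phi> p"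
        using height(2)[OF s yr] height(2)[OF t yr] by (simp add: u_def p_def)
      ultimately have "\<bar>?h s - ?h t - q p * (s - t)\<bar> * m \<le> e * m / C * norm (u - p)"
        unfolding diff by (subst (asm) along) (simp add: m_def abs_mult)
      also have "\<dots> \<le> e * m / C * (C * \<bar>s - t\<bar>)"
        using up e m C by (intro mult_left_mono) auto
      finally show "norm (?h s - ?h t - q p * (s - t)) \<le> e * norm (s - t)"
        using m C by (simp add: field_simps)
    qed
  qed
  then show ?thesis
    unfolding has_field_derivative_def p_def .
qed

lemma slope_has_derivative:
  assumes t: "t \<in> {-\<delta>..\<delta>}" and yr: "y \<in> Ylev" "r \<in> Rlev"
  shows "((\<lambda>t. q (t, height y r t, y)) has_real_derivative w (t, height y r t, y)) (at t within {-\<delta>..\<delta>})"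
proof -
  let ?h = "height y r"
  define p where "p = (t, ?h t, y)"
  obtain q' where q': "(q has_derivative q') (at p)" "q' (1, q p, 0) = w p"
    using deriv_q height(3)[OF t yr] unfolding p_def by blast
  have "((\<lambda>t. (t, ?h t, y)) has_derivative (\<lambda>k. (k, q p * k, 0))) (at t within {-\<delta>..\<delta>})"
    using height_has_derivative[OF t yr] unfolding has_field_derivative_def p_def
    by (intro derivative_intros) auto
  from has_derivative_compose[OF this, of q q'] q'(1)
  have "((\<lambda>t. q (t, ?h t, y)) has_derivative (\<lambda>k. q' (k, q p * k, 0))) (at t within {-\<delta>..\<delta>})"
    by (simp add: p_def)
  moreover have "q' (k, q p * k, 0) = w p * k" for k
    using linear_scale[OF has_derivative_linear[OF q'(1)], of k "(1, q p, 0)"] q'(2)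
    by (simp add: mult.commute)
  ultimately show ?thesis
    by (simp add: has_field_derivative_def p_def)
qed

lemma D1_height:
  assumes "t \<in> {-\<delta>..\<delta>}" "y \<in> Ylev" "r \<in> Rlev"
  shows "D1 {-\<delta>..\<delta>} (height y r) t = q (t, height y r t, y)"
  by (rule D1_eq[OF _ assms(1) height_has_derivative[OF assms]]) (use \<delta>_pos in simp)

lemma D1_height_has_derivative:
  assumes "t \<in> {-\<delta>..\<delta>}" "y \<in> Ylev" "r \<in> Rlev"
  shows "(D1 {-\<delta>..\<delta>} (height y r) has_real_derivative w (t, height y r t, y)) (at t within {-\<delta>..\<delta>})"
  by (rule has_field_derivative_transform_within[OF slope_has_derivative[OF assms] zero_less_one assms(1)])
     (rule D1_height[symmetric, OF _ assms(2,3)])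

lemma D2_height:
  assumes "t \<in> {-\<delta>..\<delta>}" "y \<in> Ylev" "r \<in> Rlev"
  shows "D2 {-\<delta>..\<delta>} (height y r) t = w (t, height y r t, y)"
  unfolding D2_def
  by (rule D1_eq[OF _ assms(1) D1_height_has_derivative[OF assms]]) (use \<delta>_pos in simp)

lemma height_in_C2_space:
  assumes "y \<in> Ylev" "r \<in> Rlev"
  shows "height y r \<in> C2_space {-\<delta>..\<delta>}"
proof -
  have "height y r differentiable_on {-\<delta>..\<delta>}" "D1 {-\<delta>..\<delta>} (height y r) differentiable_on {-\<delta>..\<delta>}"
    by (rule has_real_derivative_imp_differentiable_on, erule height_has_derivative[OF _ assms])
       (rule has_real_derivative_imp_differentiable_on, erule D1_height_has_derivative[OF _ assms])
  moreover from this(1) have "continuous_on {-\<delta>..\<delta>} (\<lambda>t. w (t, height y r t, y))"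
    using height(3) assms
    by (intro continuous_on_compose2[OF cont_w] continuous_intros differentiable_imp_continuous_on) auto
  then have "continuous_on {-\<delta>..\<delta>} (D2 {-\<delta>..\<delta>} (height y r))"
    by (rule continuous_on_eq) (use assms in \<open>auto simp: D2_height\<close>)
  ultimately show ?thesis
    by (simp add: C2_space_def height_def)
qed

lemma level_set_eq_graph:
  assumes "y \<in> Ylev" "r \<in> Rlev"
  shows "{(t, x). t \<in> {-\<delta>..\<delta>} \<and> x \<in> {-\<sigma><..<\<sigma>} \<and> \<Phi> (t, x, y) = r} =
    {(t, x). t \<in> {-\<delta>..\<delta>} \<and> x = height y r t}"
proof -
  have "x \<in> {-\<sigma><..<\<sigma>} \<and> \<Phi> (t, x, y) = r \<longleftrightarrow> x = height y r t" if "t \<in> {-\<delta>..\<delta>}" for t x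
  proof
    assume "x \<in> {-\<sigma><..<\<sigma>} \<and> \<Phi> (t, x, y) = r"
    then show "x = height y r t"
      using height_eqI[OF that assms] by (metis abs_less_iff greaterThanLessThan_iff minus_less_iff)
  next
    assume "x = height y r t"
    then show "x \<in> {-\<sigma><..<\<sigma>} \<and> \<Phi> (t, x, y) = r"
      using height(1,2)[OF that assms] by (simp add: abs_less_iff minus_less_iff)
  qed
  then show ?thesis
    by blast
qed

section \<open>Jets against parameters\<close>

lemma pointwise_height:
  assumes "t \<in> {-\<delta>..\<delta>}" "y \<in> Ylev" "r \<in> Rlev" "y' \<in> Ylev" "r' \<in> Rlev"
  shows "pointwise_C2_diff {-\<delta>..\<delta>} (height y r) (height y' r') t =
    \<bar>height y r t - height y' r' t\<bar> +
    \<bar>q (t, height y r t, y) - q (t, height y' r' t, y')\<bar> +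
    \<bar>w (t, height y r t, y) - w (t, height y' r' t, y')\<bar>"
  unfolding pointwise_C2_diff_def D1_height[OF assms(1-3)] D1_height[OF assms(1,4,5)]
    D2_height[OF assms(1-3)] D2_height[OF assms(1,4,5)] ..

text \<open>\<open>jet_lower\<close> recovers \<open>y - y'\<close> from the jets. The levels are
  values of \<Phi> at two points that differ only in height and \<open>y\<close>, so the Lipschitz
  bound then recovers \<open>r - r'\<close>; the constant adds up both estimates.\<close>

lemma parameter_le_pointwise:
  assumes "t \<in> {-\<delta>..\<delta>}" "y \<in> Ylev" "r \<in> Rlev" "y' \<in> Ylev" "r' \<in> Rlev"
  shows "norm ((y, r) - (y', r')) \<le>
    (L + (L + 1) / c) * pointwise_C2_diff {-\<delta>..\<delta>} (height y r) (height y' r') t"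
proof -
  let ?P = "pointwise_C2_diff {-\<delta>..\<delta>} (height y r) (height y' r') t"
  note h = height[OF assms(1,2,3)] and h' = height[OF assms(1,4,5)]
  have x: "\<bar>height y r t - height y' r' t\<bar> \<le> ?P"
    by (simp add: pointwise_C2_diff_def)
  have "c * norm (y - y') \<le> ?P"
    unfolding pointwise_height[OF assms] using h h' by (intro jet_lower)
  then have y: "norm (y - y') \<le> ?P / c"
    using pos by (simp add: field_simps)
  have "\<bar>r - r'\<bar> = \<bar>\<Phi> (t, height y r t, y) - \<Phi> (t, height y' r' t, y')\<bar>"
    using h h' by simp
  also have "\<dots> \<le> L * norm ((t, height y r t, y) - (t, height y' r' t, y'))"
    using h h' by (intro lipschitz)
  also have "\<dots> \<le> L * (\<bar>height y r t - height y' r' t\<bar> + norm (y - y'))"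
    using pos norm_triple_le[of 0 "height y r t - height y' r' t" "y - y'"]
    by (intro mult_left_mono) auto
  also have "\<dots> \<le> L * (?P + ?P / c)"
    using pos x y by (intro mult_left_mono add_mono) auto
  finally have r: "\<bar>r - r'\<bar> \<le> L * (?P + ?P / c)" .
  have "norm ((y, r) - (y', r')) \<le> norm (y - y') + \<bar>r - r'\<bar>"
    using norm_Pair_le[of "y - y'" "r - r'"] by simp
  also have "\<dots> \<le> ?P / c + L * (?P + ?P / c)"
    by (intro add_mono y r)
  also have "\<dots> = (L + (L + 1) / c) * ?P"
    by (simp add: algebra_simps add_divide_distrib)
  finally show ?thesis .
qed

text \<open>The parameters bound the height difference by \<open>parameter_upper\<close>; after that
  \<open>q\<close> and \<open>w\<close> are Lipschitz functions of the point on the curve.\<close>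

lemma pointwise_upper:
  assumes "t \<in> {-\<delta>..\<delta>}" "y \<in> Ylev" "r \<in> Rlev" "y' \<in> Ylev" "r' \<in> Rlev"
  shows "pointwise_C2_diff {-\<delta>..\<delta>} (height y r) (height y' r') t \<le>
    (1 + 2 * L) * (3 + 2 * L) * norm ((y, r) - (y', r'))"
proof -
  let ?x = "height y r t - height y' r' t" and ?z = "norm ((y, r) - (y', r'))"
  note h = height[OF assms(1,2,3)] and h' = height[OF assms(1,4,5)]
  have yz: "norm (y - y') \<le> ?z" and rz: "\<bar>r - r'\<bar> \<le> ?z"
    using norm_fst_le[of "y - y'" "r - r'"] norm_snd_le[of "r - r'" "y - y'"] by auto
  have "\<bar>?x\<bar> \<le> 2 * \<bar>r - r'\<bar> + 2 * L * norm (y - y')"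
    using parameter_upper[of t "height y r t" "height y' r' t" y y'] h h' assms by auto
  also have "\<dots> \<le> 2 * ?z + 2 * L * ?z"
    using pos yz rz by (intro add_mono mult_left_mono) auto
  finally have x: "\<bar>?x\<bar> \<le> (2 + 2 * L) * ?z"
    by (simp add: algebra_simps)
  \<comment> \<open>The distance of the two points on the curves: \<open>2 + 2 * L\<close> in its
    bound comes from the heights, and 1 from \<open>y\<close>.\<close>
  define N where "N = norm ((t, height y r t, y) - (t, height y' r' t, y'))"
  have N: "N \<le> (3 + 2 * L) * ?z"
    using norm_triple_le[of 0 ?x "y - y'"] x yz by (simp add: N_def algebra_simps)
  have "\<bar>?x\<bar> \<le> N"
    using norm_snd_le[of "(?x, y - y')" "0::real"] norm_fst_le[of ?x "y - y'"] by (simp add: N_def)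
  moreover have "\<bar>q (t, height y r t, y) - q (t, height y' r' t, y')\<bar> \<le> L * N"
    "\<bar>w (t, height y r t, y) - w (t, height y' r' t, y')\<bar> \<le> L * N"
    unfolding N_def using h h' by (intro lipschitz; simp)+
  ultimately have "pointwise_C2_diff {-\<delta>..\<delta>} (height y r) (height y' r') t \<le> (1 + 2 * L) * N"
    unfolding pointwise_height[OF assms] by (simp add: algebra_simps)
  also have "\<dots> \<le> (1 + 2 * L) * ((3 + 2 * L) * ?z)"
    using pos N by (intro mult_left_mono) auto
  finally show ?thesis
    by (simp add: mult.assoc)
qed

lemma pointwise_lower_const:
  obtains \<epsilon> where "\<epsilon> > 0" "\<And>t y r y' r'. t \<in> {-\<delta>..\<delta>} \<Longrightarrow> y \<in> Ylev \<Longrightarrow> r \<in> Rlev \<Longrightarrow> y' \<in> Ylev \<Longrightarrow> r' \<in> Rlev \<Longrightarrow>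
    \<epsilon> * norm ((y, r) - (y', r')) \<le> pointwise_C2_diff {-\<delta>..\<delta>} (height y r) (height y' r') t"
proof -
  define X where "X = L + (L + 1) / c"
  have X: "X > 0"
    unfolding X_def using pos by (intro add_pos_pos divide_pos_pos) auto
  show thesis
  proof (rule that)
    show "inverse X > 0"
      using X by simp
    show "inverse X * norm ((y, r) - (y', r')) \<le>
        pointwise_C2_diff {-\<delta>..\<delta>} (height y r) (height y' r') t"
      if "t \<in> {-\<delta>..\<delta>}" "y \<in> Ylev" "r \<in> Rlev" "y' \<in> Ylev" "r' \<in> Rlev" for t y r y' r'
      using mult_left_mono[OF parameter_le_pointwise[OF that, folded X_def], of "inverse X"] X
      by (simp add: mult.assoc[symmetric] del: diff_Pair)
  qed
qed

lemma cinematic_height: "\<exists>K D. cinematic_family {-\<delta>..\<delta>} K D {height y r | y r. y \<in> Ylev \<and> r \<in> Rlev}"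
proof -
  obtain \<epsilon> where \<epsilon>: "\<epsilon> > 0" "\<And>t y r y' r'. t \<in> {-\<delta>..\<delta>} \<Longrightarrow> y \<in> Ylev \<Longrightarrow> r \<in> Rlev \<Longrightarrow> y' \<in> Ylev \<Longrightarrow> r' \<in> Rlev \<Longrightarrow>
    \<epsilon> * norm ((y, r) - (y', r')) \<le> pointwise_C2_diff {-\<delta>..\<delta>} (height y r) (height y' r') t"
    using pointwise_lower_const by blast
  have "\<exists>K D. cinematic_family {-\<delta>..\<delta>} K D ((\<lambda>(y, r). height y r) ` (Ylev \<times> Rlev))"
    using \<delta>_pos \<epsilon> pointwise_upper height_in_C2_space
    by (intro cinematic_family_param[where c = \<epsilon> and L = "(1 + 2 * L) * (3 + 2 * L)"])
       (auto simp: Ylev_def Rlev_def intro!: bounded_Times simp del: diff_Pair)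
  moreover have "(\<lambda>(y, r). height y r) ` (Ylev \<times> Rlev) = {height y r | y r. y \<in> Ylev \<and> r \<in> Rlev}"
    by auto
  ultimately show ?thesis
    by simp
qed

end

section \<open>The nondegeneracy condition at the origin\<close>

text \<open>On vectors (0, h, k) the linear map to (h, q', w') is injective, as h is read off
  directly and \<open>B\<close> then controls k. The lower bound survives linearisation errors that
  are small multiples of |h| + |k|: the part in k is taken from \<open>B\<close>, the part in h
  joins the first jet coordinate.\<close>

lemma jet_lower_bound:
  fixes q w :: "real \<times> real \<times> 'b::euclidean_space \<Rightarrow> real"
  assumes q: "has_strict_derivative q q' 0" and w: "has_strict_derivative w w' 0"
    and B: "B > 0" "\<And>k. B * norm k \<le> \<bar>q' (0, 0, k)\<bar> + \<bar>w' (0, 0, k)\<bar>"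
  shows "\<exists>c>0. \<forall>\<^sub>F (u, v) in nhds 0 \<times>\<^sub>F nhds 0. fst u = fst v \<longrightarrow>
    c * norm (snd (snd (u - v))) \<le> \<bar>fst (snd (u - v))\<bar> + \<bar>q u - q v\<bar> + \<bar>w u - w v\<bar>"
proof -
  \<comment> \<open>Collects all coefficients of |h|: the two x_2-derivatives and B/4 from each of
    the two errors. The added 1 makes \<open>M \<ge> 1\<close>, so that the differences of
    \<open>q\<close> and \<open>w\<close> may be multiplied by \<open>M\<close> as well.\<close>
  define M where "M = \<bar>q' (0, 1, 0)\<bar> + \<bar>w' (0, 1, 0)\<bar> + B / 2 + 1"
  have M: "M \<ge> 1"
    using B(1) by (simp add: M_def)
  have split: "l (0, h, k) = h * l (0, 1, 0) + l (0, 0, k)"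
    if "bounded_linear l" for l :: "real \<times> real \<times> 'b \<Rightarrow> real" and h k
  proof -
    interpret bounded_linear l by fact
    show ?thesis
      using add[of "h *\<^sub>R (0, 1, 0)" "(0, 0, k)"] scaleR[of h "(0, 1, 0)"] by simp
  qed
  have bl: "bounded_linear q'" "bounded_linear w'"
    using q w by (auto simp: has_strict_derivative_def)
  \<comment> \<open>Two errors of relative size B/4 consume half of \<open>B\<close> and leave B/2
    in front of \<open>norm k\<close>.\<close>
  have B4: "B / 4 > 0"
    using B(1) by simp
  have main: "B / 2 * norm (snd (snd (u - v))) \<le> M * (\<bar>fst (snd (u - v))\<bar> + \<bar>q u - q v\<bar> + \<bar>w u - w v\<bar>)"
    if uv: "fst u = fst v" "\<bar>q u - q v - q' (u - v)\<bar> \<le> B / 4 * norm (u - v)"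
      "\<bar>w u - w v - w' (u - v)\<bar> \<le> B / 4 * norm (u - v)" for u v
  proof -
    define h k where "h = fst (snd (u - v))" and "k = snd (snd (u - v))"
    have d: "u - v = (0, h, k)"
      using uv(1) by (simp add: h_def k_def prod_eq_iff)
    have n: "norm (u - v) \<le> \<bar>h\<bar> + norm k"
      using norm_Pair_le[of "0::real" "(h, k)"] norm_Pair_le[of h k] by (simp add: d)
    have e: "B / 4 * norm (u - v) \<le> B / 4 * (\<bar>h\<bar> + norm k)"
      using n B(1) by (intro mult_left_mono) auto
    have q1: "\<bar>q' (0, 0, k)\<bar> \<le> \<bar>q' (u - v)\<bar> + \<bar>h\<bar> * \<bar>q' (0, 1, 0)\<bar>"
      unfolding d split[OF bl(1), of h k] by (simp add: abs_mult[symmetric])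
    have w1: "\<bar>w' (0, 0, k)\<bar> \<le> \<bar>w' (u - v)\<bar> + \<bar>h\<bar> * \<bar>w' (0, 1, 0)\<bar>"
      unfolding d split[OF bl(2), of h k] by (simp add: abs_mult[symmetric])
    have q2: "\<bar>q' (u - v)\<bar> \<le> \<bar>q u - q v\<bar> + B / 4 * (\<bar>h\<bar> + norm k)"
      using uv(2) e by linarith
    have w2: "\<bar>w' (u - v)\<bar> \<le> \<bar>w u - w v\<bar> + B / 4 * (\<bar>h\<bar> + norm k)"
      using uv(3) e by linarith
    have "B * norm k \<le> \<bar>q u - q v\<bar> + \<bar>w u - w v\<bar> + B / 2 * norm k +
        \<bar>h\<bar> * (\<bar>q' (0, 1, 0)\<bar> + \<bar>w' (0, 1, 0)\<bar> + B / 2)"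
      using order.trans[OF B(2)[of k] add_mono[OF order.trans[OF q1 add_right_mono[OF q2]]
        order.trans[OF w1 add_right_mono[OF w2]]]] by (simp add: algebra_simps)
    also have "\<bar>h\<bar> * (\<bar>q' (0, 1, 0)\<bar> + \<bar>w' (0, 1, 0)\<bar> + B / 2) \<le> \<bar>h\<bar> * M"
      by (intro mult_left_mono) (auto simp: M_def)
    finally have "B / 2 * norm k \<le> \<bar>q u - q v\<bar> + \<bar>w u - w v\<bar> + \<bar>h\<bar> * M"
      by simp
    also have "\<dots> \<le> M * \<bar>q u - q v\<bar> + M * \<bar>w u - w v\<bar> + \<bar>h\<bar> * M"
      using mult_right_mono[OF M, of "\<bar>q u - q v\<bar>"] mult_right_mono[OF M, of "\<bar>w u - w v\<bar>"] by simp
    finally show ?thesis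
      by (simp add: h_def k_def algebra_simps)
  qed
  have "\<forall>\<^sub>F (u, v) in nhds 0 \<times>\<^sub>F nhds 0. fst u = fst v \<longrightarrow>
      B / (2 * M) * norm (snd (snd (u - v))) \<le> \<bar>fst (snd (u - v))\<bar> + \<bar>q u - q v\<bar> + \<bar>w u - w v\<bar>"
    using has_strict_derivativeD[OF q B4] has_strict_derivativeD[OF w B4]
  proof eventually_elim
    case (elim uv)
    obtain u v where uv: "uv = (u, v)"
      by (cases uv)
    show ?case
      using main[of u v] elim M unfolding uv by (simp add: field_simps)
  qed
  then show ?thesis
    using B(1) M by (intro exI[of _ "B / (2 * M)"]) auto
qed

text \<open>Each estimate of the locale holds for all pairs of points near 0; finitely many such
  conditions hold together on one neighbourhood, which is shrunk to a ball inside
  \<open>U\<close>.\<close>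

lemma level_curves_exist:
  fixes \<Phi> q w :: "real \<times> real \<times> 'b::euclidean_space \<Rightarrow> real"
  assumes U: "open U" "0 \<in> U" and \<Phi>_0: "\<Phi> 0 = 0"
    and \<Phi>: "has_strict_derivative \<Phi> \<Phi>' 0" "\<And>h. \<Phi>' (0, h, 0) = h"
    and q: "has_strict_derivative q q' 0" and w: "has_strict_derivative w w' 0"
    and B: "B > 0" "\<And>k. B * norm k \<le> \<bar>q' (0, 0, k)\<bar> + \<bar>w' (0, 0, k)\<bar>"
    and deriv_\<Phi>: "\<And>p. p \<in> U \<Longrightarrow>
      \<exists>D. (\<Phi> has_derivative D) (at p) \<and> D (1, q p, 0) = 0 \<and> D (0, 1, 0) \<noteq> 0"
    and deriv_q: "\<And>p. p \<in> U \<Longrightarrow> \<exists>D. (q has_derivative D) (at p) \<and> D (1, q p, 0) = w p"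
    and cont_w: "continuous_on U w"
  shows "\<exists>\<rho> L c. level_curves \<Phi> q w \<rho> L c \<and> ball 0 \<rho> \<subseteq> U"
proof -
  obtain L1 L2 L3 where L: "L1 > 0" "L2 > 0" "L3 > 0"
    "\<forall>\<^sub>F (u, v) in nhds 0 \<times>\<^sub>F nhds 0. \<bar>\<Phi> u - \<Phi> v\<bar> \<le> L1 * norm (u - v)"
    "\<forall>\<^sub>F (u, v) in nhds 0 \<times>\<^sub>F nhds 0. \<bar>q u - q v\<bar> \<le> L2 * norm (u - v)"
    "\<forall>\<^sub>F (u, v) in nhds 0 \<times>\<^sub>F nhds 0. \<bar>w u - w v\<bar> \<le> L3 * norm (u - v)"
    using has_strict_derivative_lipschitz[OF \<Phi>(1)] has_strict_derivative_lipschitz[OF q]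
      has_strict_derivative_lipschitz[OF w] by blast
  obtain c where c: "c > 0"
    "\<forall>\<^sub>F (u, v) in nhds 0 \<times>\<^sub>F nhds 0. fst u = fst v \<longrightarrow>
      c * norm (snd (snd (u - v))) \<le> \<bar>fst (snd (u - v))\<bar> + \<bar>q u - q v\<bar> + \<bar>w u - w v\<bar>"
    using jet_lower_bound[OF q w B] by blast
  define G where "G u v \<longleftrightarrow>
    \<bar>\<Phi> u - \<Phi> v\<bar> \<le> L1 * norm (u - v) \<and> \<bar>q u - q v\<bar> \<le> L2 * norm (u - v) \<and>
    \<bar>w u - w v\<bar> \<le> L3 * norm (u - v) \<and> \<bar>\<Phi> u - \<Phi> v - \<Phi>' (u - v)\<bar> \<le> 1 / 2 * norm (u - v) \<and>
    (fst u = fst v \<longrightarrow>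
      c * norm (snd (snd (u - v))) \<le> \<bar>fst (snd (u - v))\<bar> + \<bar>q u - q v\<bar> + \<bar>w u - w v\<bar>)" for u v
  \<comment> \<open>The derivative of \<Phi> in \<open>x\<close> is 1 at the origin, so an error of
    at most half the increment leaves the growth rate 1/2 that \<open>increasing\<close>
    demands.\<close>
  have "(1/2::real) > 0"
    by simp
  from has_strict_derivativeD[OF \<Phi>(1) this] L(4,5,6) c(2)
  have "\<forall>\<^sub>F uv in nhds 0 \<times>\<^sub>F nhds 0. G (fst uv) (snd uv)"
    by eventually_elim (simp add: G_def case_prod_unfold)
  then obtain Q where Q: "eventually Q (nhds 0)" "\<And>u v. Q u \<Longrightarrow> Q v \<Longrightarrow> G u v"
    unfolding eventually_prod_same by auto
  have "eventually (\<lambda>p. p \<in> U) (nhds 0)"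
    using U by (rule eventually_nhds_in_open)
  with Q(1) have "eventually (\<lambda>p. Q p \<and> p \<in> U) (nhds 0)"
    by (rule eventually_conj)
  then obtain \<rho> where \<rho>: "\<rho> > 0" "\<And>p. p \<in> ball 0 \<rho> \<Longrightarrow> Q p \<and> p \<in> U"
    unfolding eventually_nhds_metric by (auto simp: dist_commute)
  have G: "G u v" if "u \<in> ball 0 \<rho>" "v \<in> ball 0 \<rho>" for u v
    using that \<rho>(2) Q(2) by blast
  define L where "L = max L1 (max L2 L3)"
  have "level_curves \<Phi> q w \<rho> L c"
  proof
    show "\<rho> > 0" "L > 0" "c > 0" "\<Phi> 0 = 0"
      using \<rho> L c \<Phi>_0 by (auto simp: L_def)
    show "\<exists>D. (\<Phi> has_derivative D) (at p) \<and> D (1, q p, 0) = 0 \<and> D (0, 1, 0) \<noteq> 0"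
      "\<exists>D. (q has_derivative D) (at p) \<and> D (1, q p, 0) = w p" if "p \<in> ball 0 \<rho>" for p
      using that \<rho>(2) deriv_\<Phi> deriv_q by blast+
    show "continuous_on (ball 0 \<rho>) w"
      using cont_w by (rule continuous_on_subset) (use \<rho>(2) in blast)
    fix u v :: "real \<times> real \<times> 'b" assume uv: "u \<in> ball 0 \<rho>" "v \<in> ball 0 \<rho>"
    have "L1 * norm (u - v) \<le> L * norm (u - v)" "L2 * norm (u - v) \<le> L * norm (u - v)"
      "L3 * norm (u - v) \<le> L * norm (u - v)"
      by (intro mult_right_mono; simp add: L_def)+
    then show "\<bar>\<Phi> u - \<Phi> v\<bar> \<le> L * norm (u - v)" "\<bar>q u - q v\<bar> \<le> L * norm (u - v)"
      "\<bar>w u - w v\<bar> \<le> L * norm (u - v)"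
      using G[OF uv] unfolding G_def by linarith+
  next
    fix t x x' :: real and y :: 'b
    assume "(t, x, y) \<in> ball 0 \<rho>" "(t, x', y) \<in> ball 0 \<rho>" and "x < x'"
    from G[OF this(2,1)] \<open>x < x'\<close>
    have "\<bar>\<Phi> (t, x', y) - \<Phi> (t, x, y) - (x' - x)\<bar> \<le> 1 / 2 * (x' - x)"
      unfolding G_def by (simp add: \<Phi>(2) norm_Pair)
    from abs_le_D2[OF this] show "(x' - x) / 2 \<le> \<Phi> (t, x', y) - \<Phi> (t, x, y)"
      by (simp add: field_simps)
  next
    fix t x x' :: real and y y' :: 'b
    assume "(t, x, y) \<in> ball 0 \<rho>" "(t, x', y') \<in> ball 0 \<rho>"
    from G[OF this] show "c * norm (y - y') \<le>
        \<bar>x - x'\<bar> + \<bar>q (t, x, y) - q (t, x', y')\<bar> + \<bar>w (t, x, y) - w (t, x', y')\<bar>"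
      by (simp add: G_def)
  qed
  then show ?thesis
    using \<rho>(2) by blast
qed

text \<open>The quotient of \<open>g s\<close> by s^n tends to 0 for n < 3. For n = 2 the function
  \<open>g1\<close> is known to be differentiable only at 0, and l'Hopital's rule converts the limit
  g2/2 of g1(s)/(2 s) into the limit of g(s)/s^2.\<close>

lemma cubic_bound_derivatives_zero:
  fixes g :: "real \<Rightarrow> real"
  assumes big: "g \<in> O[at 0](\<lambda>s. s ^ 3)"
    and g: "\<forall>\<^sub>F s in nhds 0. (g has_real_derivative g1 s) (at s)"
    and g1: "(g1 has_real_derivative g2) (at 0)"
  shows "g 0 = 0" "g1 0 = 0" "g2 = 0"
proof -
  have g0: "(g has_real_derivative g1 0) (at 0)"
    using g by (rule eventually_nhds_x_imp_x)
  have lim: "((\<lambda>s. g s / s ^ n) \<longlongrightarrow> 0) (at 0)" if "n < 3" for n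
  proof (rule smalloD_tendsto)
    have "((\<lambda>s::real. s ^ (3 - n)) \<longlongrightarrow> 0) (at 0)"
      using that by (auto intro!: tendsto_eq_intros)
    then have "(\<lambda>s::real. s ^ n * s ^ (3 - n)) \<in> o[at 0](\<lambda>s. s ^ n * 1)"
      by (intro landau_o.big_small_mult smalloI_tendsto) auto
    then have "(\<lambda>s::real. s ^ 3) \<in> o[at 0](\<lambda>s. s ^ n)"
      using that by (simp add: power_add[symmetric])
    with big show "g \<in> o[at 0](\<lambda>s. s ^ n)"
      by (rule landau_o.big_small_trans)
  qed
  have "(g \<longlongrightarrow> g 0) (at 0)"
    using DERIV_isCont[OF g0] by (simp add: isCont_def)
  moreover have "(g \<longlongrightarrow> 0) (at 0)"
    using lim[of 0] by simp
  ultimately show 0: "g 0 = 0"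
    by (rule tendsto_unique[OF at_neq_bot])
  have "((\<lambda>s. g s / s) \<longlongrightarrow> g1 0) (at 0)"
    using g0 by (simp add: has_field_derivative_iff 0)
  moreover have "((\<lambda>s. g s / s) \<longlongrightarrow> 0) (at 0)"
    using lim[of 1] by simp
  ultimately show 1: "g1 0 = 0"
    by (rule tendsto_unique[OF at_neq_bot])
  have "((\<lambda>s. g1 s / s) \<longlongrightarrow> g2) (at 0)"
    using g1 by (simp add: has_field_derivative_iff 1)
  then have "((\<lambda>s. g1 s / (2 * s)) \<longlongrightarrow> g2 / 2) (at 0)"
    by (auto dest: tendsto_divide[OF _ tendsto_const[of 2]] simp: mult.commute)
  then have "((\<lambda>s. g s / s ^ 2) \<longlongrightarrow> g2 / 2) (at 0)"
  proof (rule lhopital[rotated -1])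
    show "(g \<longlongrightarrow> 0) (at 0)" by fact
    show "\<forall>\<^sub>F s in at 0. (g has_real_derivative g1 s) (at s)"
      using g by (auto simp: eventually_at_filter elim: eventually_mono)
    show "\<forall>\<^sub>F s in at 0. ((\<lambda>s::real. s ^ 2) has_real_derivative 2 * s) (at s)"
      by (intro always_eventually allI) (auto intro!: derivative_eq_intros)
  qed (auto intro!: tendsto_eq_intros simp: eventually_at_filter)
  from tendsto_unique[OF at_neq_bot this lim[of 2]] show "g2 = 0"
    by simp
qed

section \<open>Level curves of a \<open>C\<^sup>3\<close> function\<close>

definition partial :: "'a::euclidean_space \<Rightarrow> ('a \<Rightarrow> real) \<Rightarrow> 'a \<Rightarrow> real" where
  "partial b f z = frechet_derivative f (at z) b"

lemma finite_Ck_norm_partial: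
  assumes "finite_Ck_norm (Suc k) f U" "b \<in> Basis"
  shows "finite_Ck_norm k (partial b f) U"
  unfolding partial_def[abs_def] by (rule finite_Ck_norm_SucD(2)[OF assms])

lemma Basis_e1_e2 [simp]: "(1, 0, 0) \<in> (Basis :: (real \<times> real \<times> 'b::euclidean_space) set)"
  "(0, 1, 0) \<in> (Basis :: (real \<times> real \<times> 'b::euclidean_space) set)"
  by (auto simp: Basis_prod_def image_iff zero_prod_def)

lemma has_derivative_slice:
  fixes f :: "real \<times> real \<times> 'b::euclidean_space \<Rightarrow> real"
  assumes "(f has_derivative f') (at (x1, x2, y))"
  shows "((\<lambda>s. f (s, x2, y)) has_real_derivative f' (1, 0, 0)) (at x1)"
    and "((\<lambda>s. f (x1, s, y)) has_real_derivative f' (0, 1, 0)) (at x2)"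
    and "((\<lambda>y. f (x1, x2, y)) has_derivative (\<lambda>k. f' (0, 0, k))) (at y)"
proof -
  have lin: "linear f'"
    using assms by (rule has_derivative_linear)
  have line: "((\<lambda>s. (s, x2, y)) has_derivative (\<lambda>h. (h, 0, 0))) (at x1)"
    "((\<lambda>s. (x1, s, y)) has_derivative (\<lambda>h. (0, h, 0))) (at x2)"
    "((\<lambda>y. (x1, x2, y)) has_derivative (\<lambda>k. (0, 0, k))) (at y)"
    by (intro derivative_intros)+
  have hom: "f' (h, 0, 0) = f' (1, 0, 0) * h" "f' (0, h, 0) = f' (0, 1, 0) * h" for h
    using linear_scale[OF lin, of h "(1, 0, 0)"] linear_scale[OF lin, of h "(0, 1, 0)"]
    by (simp_all add: mult.commute)
  have "((\<lambda>s. f (s, x2, y)) has_derivative (\<lambda>h. f' (h, 0, 0))) (at x1)"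
    "((\<lambda>s. f (x1, s, y)) has_derivative (\<lambda>h. f' (0, h, 0))) (at x2)"
    by (rule has_derivative_compose[OF line(1) assms] has_derivative_compose[OF line(2) assms])+
  moreover have "(\<lambda>h. f' (h, 0, 0)) = (*) (f' (1, 0, 0))" "(\<lambda>h. f' (0, h, 0)) = (*) (f' (0, 1, 0))"
    by (rule ext, rule hom)+
  ultimately show "((\<lambda>s. f (s, x2, y)) has_real_derivative f' (1, 0, 0)) (at x1)"
    "((\<lambda>s. f (x1, s, y)) has_real_derivative f' (0, 1, 0)) (at x2)"
    unfolding has_field_derivative_def by simp_all
  show "((\<lambda>y. f (x1, x2, y)) has_derivative (\<lambda>k. f' (0, 0, k))) (at y)"
    by (rule has_derivative_compose[OF line(3) assms])
qed

text \<open>\<open>dx1\<close> and \<open>dx2\<close> are one-variable derivatives along slices. On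
  \<open>U\<close> they are values of the Frechet derivative, the form in which
  \<open>finite_Ck_norm\<close> can be iterated.\<close>

lemma dx_eq_partial:
  assumes "finite_Ck_norm (Suc k) f U" "z \<in> U"
  shows "dx1 f z = partial (1, 0, 0) f z" "dx2 f z = partial (0, 1, 0) f z"
proof -
  obtain x1 x2 y where z: "z = (x1, x2, y)"
    by (cases z)
  note d = finite_Ck_norm_SucD(1)[OF assms, unfolded z]
  show "dx1 f z = partial (1, 0, 0) f z" "dx2 f z = partial (0, 1, 0) f z"
    using DERIV_imp_deriv[OF has_derivative_slice(1)[OF d]] DERIV_imp_deriv[OF has_derivative_slice(2)[OF d]]
    by (simp_all add: z dx1_def dx2_def partial_def)
qed

text \<open>\<open>dx1\<close> agrees with a partial derivative on \<open>U\<close> only. A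
  derivative depends just on the germ of the function, which is what identifies the iterate
  \<open>dx1 (dx1 \<Phi>)\<close> at points of \<open>U\<close>.\<close>

lemma dx1_cong_open:
  assumes "open U" "z \<in> U" "\<And>u. u \<in> U \<Longrightarrow> f u = g u"
  shows "dx1 f z = dx1 g z"
proof -
  obtain x1 x2 y where z: "z = (x1, x2, y)"
    by (cases z)
  have "open ((\<lambda>s. (s, x2, y)) -` U)"
    using assms(1) by (intro open_vimage continuous_intros)
  then have "\<forall>\<^sub>F s in nhds x1. s \<in> (\<lambda>s. (s, x2, y)) -` U"
    using assms(2) by (intro eventually_nhds_in_open) (simp_all add: z)
  then have "\<forall>\<^sub>F s in nhds x1. f (s, x2, y) = g (s, x2, y)"
    by eventually_elim (use assms(3) in auto)
  then show ?thesis
    by (auto simp: z dx1_def intro: deriv_cong_ev)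
qed

lemma has_derivative_vector_2:
  assumes "(f has_derivative f') F" "(g has_derivative g') F"
  shows "((\<lambda>x. vector [f x, g x] :: real^2) has_derivative (\<lambda>h. vector [f' h, g' h])) F"
proof -
  have eq: "(vector [s, t] :: real^2) = s *\<^sub>R axis 1 1 + t *\<^sub>R axis 2 1" for s t
    by (simp add: vec_eq_iff forall_2 axis_def)
  show ?thesis
    unfolding eq by (intro derivative_intros assms)
qed

lemma norm_vector_2_le: "norm (vector [s, t] :: real^2) \<le> \<bar>s\<bar> + \<bar>t\<bar>"
proof -
  have "norm x \<le> \<bar>x $ 1\<bar> + \<bar>x $ 2\<bar>" for x :: "real^2"
    using norm_le_l1_cart[of x] by (simp only: sum_2 real_norm_def)
  from this[of "vector [s, t]"] show ?thesis
    by (simp only: vector_2)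
qed

theorem mainTheorem3:
  fixes I J :: "real set" and Y :: "(real^2) set"
    and \<Phi> :: "real \<times> real \<times> (real^2) \<Rightarrow> real"
  assumes "open I" "is_interval I" "0 \<in> I"
    and "open J" "is_interval J" "0 \<in> J"
    and "open Y" "0 \<in> Y"
    and "finite_Ck_norm 3 \<Phi> (I \<times> J \<times> Y)"
    and "(\<lambda>(x1, x2). \<Phi> (x1, x2, 0) - x2) \<in> O[at (0, 0)](\<lambda>x. norm x ^ 3)"
    and "invertible (jacobian (\<lambda>y. cinematic_map \<Phi> (0, 0, y)) (at 0))"
  shows "\<exists>a b J' Y' R f.
    a < 0 \<and> 0 < b \<and> {a..b} \<subseteq> I \<and>
    open J' \<and> is_interval J' \<and> 0 \<in> J' \<and> J' \<subseteq> J \<and>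
    open Y' \<and> 0 \<in> Y' \<and> Y' \<subseteq> Y \<and>
    is_interval R \<and> 0 \<in> interior R \<and>
    (\<forall>y\<in>Y'. \<forall>r\<in>R. f y r \<in> C2_space {a..b} \<and>
       {(x1, x2). x1 \<in> {a..b} \<and> x2 \<in> J' \<and> \<Phi> (x1, x2, y) = r} =
       {(x1, x2). x1 \<in> {a..b} \<and> x2 = f y r x1}) \<and>
    (\<exists>K D. cinematic_family {a..b} K D {f y r | y r. y \<in> Y' \<and> r \<in> R}) \<and>
    (\<exists>\<epsilon>>0. \<forall>y\<in>Y'. \<forall>r\<in>R. \<forall>y'\<in>Y'. \<forall>r'\<in>R. \<forall>x1\<in>{a..b}.
       pointwise_C2_diff {a..b} (f y r) (f y' r') x1 \<ge> \<epsilon> * norm ((y, r) - (y', r')))"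
proof -
  define U where "U = I \<times> J \<times> Y"
  have U: "open U" "0 \<in> U"
    using assms by (auto simp: U_def zero_prod_def intro!: open_Times)
  define P1 P2 where "P1 = partial (1, 0, 0) \<Phi>" and "P2 = partial (0, 1, 0) \<Phi>"
  define P11 P12 P21 P22 where "P11 = partial (1, 0, 0) P1" and "P12 = partial (0, 1, 0) P1"
    and "P21 = partial (1, 0, 0) P2" and "P22 = partial (0, 1, 0) P2"
  have C3: "finite_Ck_norm (Suc (Suc (Suc 0))) \<Phi> U"
    using assms(9) by (simp only: U_def numeral_3_eq_3)
  have C2: "finite_Ck_norm (Suc (Suc 0)) P1 U" "finite_Ck_norm (Suc (Suc 0)) P2 U"
    unfolding P1_def P2_def by (rule finite_Ck_norm_partial[OF C3], simp)+
  have C1: "finite_Ck_norm (Suc 0) P11 U" "finite_Ck_norm (Suc 0) P12 U"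
    "finite_Ck_norm (Suc 0) P21 U" "finite_Ck_norm (Suc 0) P22 U"
    unfolding P11_def P12_def P21_def P22_def
    by (rule finite_Ck_norm_partial[OF C2(1)] finite_Ck_norm_partial[OF C2(2)], simp)+
  let ?D = "\<lambda>f z. frechet_derivative f (at z)"
  note der = finite_Ck_norm_SucD(1)[OF C3] finite_Ck_norm_SucD(1)[OF C2(1)] finite_Ck_norm_SucD(1)[OF C2(2)]
  note strict = finite_Ck_norm_has_strict_derivative[OF _ U]

  \<comment> \<open>Restricted to the coordinate axes of the x-plane the bound becomes a
    one-variable statement: the x_1-axis yields \<Phi>, \<open>P1\<close> and \<open>P11\<close> at
    0, the x_2-axis yields \<open>P2\<close>.\<close>
  have cubic: "(\<lambda>(x1, x2). \<Phi> (x1, x2, 0) - x2) \<in> O[at 0](\<lambda>x. norm x ^ 3)"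
    using assms(10) by (simp add: zero_prod_def)
  have lim1: "filterlim (\<lambda>s::real. (s, 0::real)) (at 0) (at 0)"
    and lim2: "filterlim (\<lambda>s::real. (0::real, s)) (at 0) (at 0)"
    by (auto simp: filterlim_at eventually_at_filter zero_prod_def intro!: tendsto_eq_intros)
  have slice1: "\<forall>\<^sub>F s in nhds 0. (s, 0, 0) \<in> U" and slice2: "\<forall>\<^sub>F s in nhds 0. (0, s, 0) \<in> U"
    using assms eventually_nhds_in_open[of I 0] eventually_nhds_in_open[of J 0]
    by (auto simp: U_def elim: eventually_mono)
  have 0: "(0, 0, 0) \<in> U"
    using U(2) by (simp add: zero_prod_def)
  have g1: "(\<lambda>s. \<Phi> (s, 0, 0)) \<in> O[at 0](\<lambda>s. s ^ 3)"
    using landau_o.big.compose[OF cubic lim1] by (simp add: norm_Pair flip: power_abs)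
  have "\<forall>\<^sub>F s in nhds 0. ((\<lambda>s. \<Phi> (s, 0, 0)) has_real_derivative P1 (s, 0, 0)) (at s)"
    using slice1 by eventually_elim (auto simp: P1_def partial_def intro!: has_derivative_slice(1) der)
  moreover have "((\<lambda>s. P1 (s, 0, 0)) has_real_derivative P11 (0, 0, 0)) (at 0)"
    using 0 by (auto simp: P11_def partial_def intro!: has_derivative_slice(1) der)
  ultimately have zero: "\<Phi> 0 = 0" "P1 0 = 0" "P11 0 = 0"
    using cubic_bound_derivatives_zero[OF g1] by (simp_all add: zero_prod_def)
  have g2: "(\<lambda>s. \<Phi> (0, s, 0) - s) \<in> O[at 0](\<lambda>s. s ^ 3)"
    using landau_o.big.compose[OF cubic lim2] by (simp add: norm_Pair flip: power_abs)
  have "\<forall>\<^sub>F s in nhds 0. ((\<lambda>s. \<Phi> (0, s, 0) - s) has_real_derivative P2 (0, s, 0) - 1) (at s)"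
    using slice2
    by eventually_elim (auto simp: P2_def partial_def intro!: DERIV_diff has_derivative_slice(2) der)
  moreover have "((\<lambda>s. P2 (0, s, 0)) has_real_derivative P22 (0, 0, 0)) (at 0)"
    using 0 by (auto simp: P22_def partial_def intro!: has_derivative_slice(2) der)
  from DERIV_diff[OF this DERIV_const]
  have "((\<lambda>s. P2 (0, s, 0) - 1) has_real_derivative P22 (0, 0, 0) - 0) (at 0)" .
  ultimately have "P2 (0, 0, 0) - 1 = 0"
    by (rule cubic_bound_derivatives_zero(2)[OF g2])
  then have one: "P2 0 = 1"
    by (simp add: zero_prod_def)

  \<comment> \<open>The gradient has norm 1 at 0 and \<open>P11\<close> vanishes there, so the
    quotient in \<open>cinematic_map\<close> has the same y-derivative as its numerator.\<close>
  define A where "A k = (vector [?D P1 0 (0, 0, k), ?D P11 0 (0, 0, k)] :: real^2)" for k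
  have dP: "((\<lambda>y. f (0, 0, y)) has_derivative (\<lambda>k. ?D f 0 (0, 0, k))) (at 0)"
    if "finite_Ck_norm (Suc k) f U" for f k
    using finite_Ck_norm_SucD(1)[OF that U(2)]
    by (intro has_derivative_slice(3)) (simp add: zero_prod_def)
  have "((\<lambda>y. vector [P1 (0, 0, y), P11 (0, 0, y) / norm (P1 (0, 0, y), P2 (0, 0, y))] :: real^2)
      has_derivative A) (at 0)"
  proof -
    have "(P1 (0, 0, 0), P2 (0, 0, 0)) \<noteq> 0"
      using one by (simp add: zero_prod_def)
    from has_derivative_compose[OF has_derivative_Pair[OF dP[OF C2(1)] dP[OF C2(2)]] has_derivative_norm[OF this]]
    have "((\<lambda>y. norm (P1 (0, 0, y), P2 (0, 0, y))) has_derivative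
        (\<lambda>k. (?D P1 0 (0, 0, k), ?D P2 0 (0, 0, k)) \<bullet> sgn (P1 (0, 0, 0), P2 (0, 0, 0)))) (at 0)" .
    from has_derivative_divide[OF dP[OF C1(1)] this]
    have "((\<lambda>y. P11 (0, 0, y) / norm (P1 (0, 0, y), P2 (0, 0, y))) has_derivative
        (\<lambda>k. ?D P11 0 (0, 0, k))) (at 0)"
      using zero one by (simp add: zero_prod_def)
    from has_derivative_vector_2[OF dP[OF C2(1)] this] show ?thesis
      unfolding A_def[abs_def] .
  qed
  then have "((\<lambda>y. cinematic_map \<Phi> (0, 0, y)) has_derivative A) (at 0)"
  proof (rule has_derivative_transform_within_open[OF _ assms(7,8)])
    fix y assume "y \<in> Y"
    then have y: "(0, 0, y) \<in> U"
      using assms by (simp add: U_def)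
    have "dx1 (dx1 \<Phi>) (0, 0, y) = dx1 P1 (0, 0, y)"
      by (rule dx1_cong_open[OF U(1) y]) (simp add: dx_eq_partial(1)[OF C3] P1_def)
    moreover have "dx1 P1 (0, 0, y) = P11 (0, 0, y)"
      unfolding P11_def by (rule dx_eq_partial(1)[OF C2(1) y])
    moreover have "dx1 \<Phi> (0, 0, y) = P1 (0, 0, y)" "dx2 \<Phi> (0, 0, y) = P2 (0, 0, y)"
      unfolding P1_def P2_def by (rule dx_eq_partial[OF C3 y])+
    ultimately show "vector [P1 (0, 0, y), P11 (0, 0, y) / norm (P1 (0, 0, y), P2 (0, 0, y))] =
        cinematic_map \<Phi> (0, 0, y)"
      by (simp add: cinematic_map_def grad_x_def)
  qed
  then have "linear A" "invertible (matrix A)"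
    using assms(11) frechet_derivative_at by (auto simp: jacobian_def dest: has_derivative_linear)
  then have "inj A"
    by (metis invertible_eq_bij bij_is_inj matrix_vector_mul(2))
  then obtain B where B: "B > 0" "\<And>k. B * norm k \<le> norm (A k)"
    using linear_inj_bounded_below_pos[OF \<open>linear A\<close>] by blast

  define q where "q z = - P1 z * inverse (P2 z)" for z
  \<comment> \<open>\<open>\<Phi>\<^sub>1 + \<Phi>\<^sub>2 f' = 0\<close> along a level curve; differentiating this once more gives \<open>f'' = w\<close>.\<close>
  define w where "w z = - (P11 z + (P12 z + P21 z) * q z + P22 z * (q z * q z)) * inverse (P2 z)" for z
  define m where "m = P12 0 + P21 0"
  have q0: "q 0 = 0"
    by (simp add: q_def zero)
  have inv: "has_strict_derivative (\<lambda>z. inverse (P2 z)) (\<lambda>h. - (?D P2 0 h / (P2 0)\<^sup>2)) 0"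
    using one by (intro has_strict_derivative_inverse strict[OF C2(2)]) simp
  have q: "has_strict_derivative q (\<lambda>h. - ?D P1 0 h) 0"
    using has_strict_derivative_mult[OF has_strict_derivative_minus[OF strict[OF C2(1)]] inv]
    by (simp add: q_def[abs_def] zero one)
  \<comment> \<open>Since \<open>q 0 = 0\<close>, the cross term contributes only \<open>m\<close>
    times the derivative of \<open>q\<close>, and the quadratic term nothing. The derivative of the
    factor \<open>inverse (P2 z)\<close> is multiplied by a bracket that vanishes at 0.\<close>
  have w: "has_strict_derivative w (\<lambda>h. - (?D P11 0 h - m * ?D P1 0 h)) 0"
    using has_strict_derivative_mult[OF has_strict_derivative_minus[OF
      has_strict_derivative_add[OF has_strict_derivative_add[OF strict[OF C1(1)]
        has_strict_derivative_mult[OF has_strict_derivative_add[OF strict[OF C1(2)] strict[OF C1(3)]] q]]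
        has_strict_derivative_mult[OF strict[OF C1(4)] has_strict_derivative_mult[OF q q]]]] inv]
    by (simp add: w_def[abs_def] zero one q0 m_def)

  define V where "V = U \<inter> P2 -` (- {0})"
  have V: "open V" "0 \<in> V"
    unfolding V_def using U one finite_Ck_norm_continuous_on[OF C2(2)]
    by (auto intro!: continuous_open_preimage)
  have "\<exists>\<rho> L c. level_curves \<Phi> q w \<rho> L c \<and> ball 0 \<rho> \<subseteq> V"
  proof (rule level_curves_exist[OF V zero(1) strict[OF C3] _ q w])
    have "linear (?D \<Phi> 0)"
      using der(1)[OF U(2)] by (rule has_derivative_linear)
    then show "?D \<Phi> 0 (0, h, 0) = h" for h
      using linear_scale[of "?D \<Phi> 0" h "(0, 1, 0)"] one by (simp add: P2_def partial_def)
    \<comment> \<open>With \<open>A k\<close> = (a, b), the derivatives of \<open>q\<close> and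
      \<open>w\<close> in direction \<open>k\<close> are -a and -(b - m a), a triangular transform
      of (a, b). Undoing it costs the factor 1 + |m|.\<close>
    show "B / (1 + \<bar>m\<bar>) > 0"
      using B(1) by simp
    fix k
    let ?a = "?D P1 0 (0, 0, k)" and ?b = "?D P11 0 (0, 0, k)"
    have "B * norm k \<le> \<bar>?a\<bar> + \<bar>?b\<bar>"
      using order.trans[OF B(2) norm_vector_2_le[of ?a ?b, folded A_def]] .
    also have "\<bar>?b\<bar> \<le> \<bar>?b - m * ?a\<bar> + \<bar>m\<bar> * \<bar>?a\<bar>"
      by (simp add: abs_mult[symmetric])
    also have "\<bar>?a\<bar> + \<dots> \<le> (1 + \<bar>m\<bar>) * (\<bar>- ?a\<bar> + \<bar>- (?b - m * ?a)\<bar>)"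
      by (simp add: algebra_simps abs_minus_commute)
    finally show "B / (1 + \<bar>m\<bar>) * norm k \<le> \<bar>- ?a\<bar> + \<bar>- (?b - m * ?a)\<bar>"
      by (simp add: field_simps)
  next
    fix p assume "p \<in> V"
    then have p: "p \<in> U" "P2 p \<noteq> 0"
      by (auto simp: V_def)
    have dir: "?D f p (1, s, 0) = partial (1, 0, 0) f p + s * partial (0, 1, 0) f p"
      if "(f has_derivative ?D f p) (at p)" for f s
    proof -
      interpret linear "?D f p"
        using that by (rule has_derivative_linear)
      show ?thesis
        using add[of "(1, 0, 0)" "s *\<^sub>R (0, 1, 0)"] scaleR[of s "(0, 1, 0)"] by (simp add: partial_def)
    qed
    have "?D \<Phi> p (1, q p, 0) = 0"
      using dir[OF der(1)[OF p(1)], of "q p"] p(2) by (simp add: P1_def[symmetric] P2_def[symmetric] q_def)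
    then show "\<exists>D. (\<Phi> has_derivative D) (at p) \<and> D (1, q p, 0) = 0 \<and> D (0, 1, 0) \<noteq> 0"
      using der(1)[OF p(1)] p(2) by (auto simp: P2_def partial_def)
    have "(q has_derivative (\<lambda>h. - P1 p * - (inverse (P2 p) * ?D P2 p h * inverse (P2 p)) +
        - ?D P1 p h * inverse (P2 p))) (at p)"
      unfolding q_def[abs_def] by (intro derivative_intros der p)
    \<comment> \<open>The quotient rule evaluated on the tangent vector; substituting
      \<open>q\<close> for -P1/P2 turns it into \<open>w\<close>.\<close>
    moreover have "- P1 p * - (inverse (P2 p) * ?D P2 p (1, q p, 0) * inverse (P2 p)) +
        - ?D P1 p (1, q p, 0) * inverse (P2 p) = w p"
      unfolding dir[OF der(2)[OF p(1)]] dir[OF der(3)[OF p(1)]]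
        P11_def[symmetric] P12_def[symmetric] P21_def[symmetric] P22_def[symmetric] w_def
      by (simp add: q_def algebra_simps)
    ultimately show "\<exists>D. (q has_derivative D) (at p) \<and> D (1, q p, 0) = w p"
      by blast
  next
    have "continuous_on V f" if "finite_Ck_norm k f U" for f k
      using finite_Ck_norm_continuous_on[OF that] by (rule continuous_on_subset) (auto simp: V_def)
    note cont = this[OF C1(1)] this[OF C1(2)] this[OF C1(3)] this[OF C1(4)] this[OF C2(1)] this[OF C2(2)]
    show "continuous_on V w"
      unfolding w_def[abs_def] q_def by (intro continuous_intros cont) (simp_all add: V_def)
  qed
  then obtain \<rho> L c where lc: "level_curves \<Phi> q w \<rho> L c" and sub: "ball 0 \<rho> \<subseteq> V"
    by blast
  interpret level_curves \<Phi> q w \<rho> L c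
    by fact
  have sub': "t \<in> I \<and> x \<in> J \<and> y \<in> Y" if "\<bar>t\<bar> \<le> \<delta>" "\<bar>x\<bar> \<le> \<sigma>" "y \<in> Ylev" for t x y
    using in_ball[OF that] sub by (auto simp: V_def U_def)
  have 0: "\<bar>0\<bar> \<le> \<delta>" "\<bar>0\<bar> \<le> \<sigma>" "0 \<in> Ylev"
    using \<delta>_pos \<sigma>_pos by (auto simp: Ylev_def)
  obtain \<epsilon> where \<epsilon>: "\<epsilon> > 0" "\<And>t y r y' r'. t \<in> {-\<delta>..\<delta>} \<Longrightarrow> y \<in> Ylev \<Longrightarrow> r \<in> Rlev \<Longrightarrow> y' \<in> Ylev \<Longrightarrow> r' \<in> Rlev \<Longrightarrow>
    \<epsilon> * norm ((y, r) - (y', r')) \<le> pointwise_C2_diff {-\<delta>..\<delta>} (height y r) (height y' r') t"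
    using pointwise_lower_const by blast
  show ?thesis
  \<comment> \<open>\<open>J'\<close> is the open interval in which \<open>height\<close> selects
    its value, so the part of the level set in the strip is the whole graph and nothing
    else.\<close>
  proof (rule exI[of _ "-\<delta>"], rule exI[of _ \<delta>], rule exI[of _ "{-\<sigma><..<\<sigma>}"], rule exI[of _ Ylev],
      rule exI[of _ Rlev], rule exI[of _ height], intro conjI)
    show "{-\<delta>..\<delta>} \<subseteq> I"
      using sub'[OF _ 0(2,3)] by auto
    show "{-\<sigma><..<\<sigma>} \<subseteq> J"
      using sub'[OF 0(1) _ 0(3)] by auto
    show "Ylev \<subseteq> Y"
      using sub'[OF 0(1,2)] by auto
    show "is_interval Rlev" "0 \<in> interior Rlev"
      using \<sigma>_pos by (auto simp: Rlev_def is_interval_convex_1)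
    show "\<exists>K D. cinematic_family {-\<delta>..\<delta>} K D {height y r | y r. y \<in> Ylev \<and> r \<in> Rlev}"
      by (rule cinematic_height)
    show "\<exists>\<epsilon>>0. \<forall>y\<in>Ylev. \<forall>r\<in>Rlev. \<forall>y'\<in>Ylev. \<forall>r'\<in>Rlev. \<forall>x1\<in>{-\<delta>..\<delta>}.
       pointwise_C2_diff {-\<delta>..\<delta>} (height y r) (height y' r') x1 \<ge> \<epsilon> * norm ((y, r) - (y', r'))"
      using \<epsilon> by blast
    show "\<forall>y\<in>Ylev. \<forall>r\<in>Rlev. height y r \<in> C2_space {-\<delta>..\<delta>} \<and>
       {(x1, x2). x1 \<in> {-\<delta>..\<delta>} \<and> x2 \<in> {-\<sigma><..<\<sigma>} \<and> \<Phi> (x1, x2, y) = r} =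
       {(x1, x2). x1 \<in> {-\<delta>..\<delta>} \<and> x2 = height y r x1}"
      using height_in_C2_space level_set_eq_graph by blast
    show "is_interval {-\<sigma><..<\<sigma>}"
      by (simp add: is_interval_convex_1)
    show "open Ylev"
      by (simp add: Ylev_def)
  qed (use \<delta>_pos \<sigma>_pos 0(3) in simp_all)
qed

end
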